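(* Assume that $(z^*,\boldsymbol{A})$ is generated from a stochastic block model with random labels, fully observed, with parameters $(\alpha^*,\boldsymbol{Q}^* )\in\mathcal{Q}$ such that: (A1) $\alpha^*=\alpha^0$ for some fixed $\alpha^0=(\alpha^0_1,\dots,\alpha^0_k)$ with $\alpha^0_a>0$ for all $a\in\{1,\dots,k\}$; (A2) $\boldsymbol{Q}^*=\rho_n\boldsymbol{Q}^0$ for some fixed symmetric $k\times k$ matrix $\boldsymbol{Q}^0$ with positive entries such that $\sum_{a,b=1}^k\alpha^0_a\alpha^0_b\boldsymbol{Q}^0_{ab}=1$. Assume moreover that $\boldsymbol{Q}^0$ has no identical columns and that $\rho_n\gg\log(n)/n$. Then there exists a constant $C_{\boldsymbol{Q}^0}>0$ depending on $\boldsymbol{Q}^0$ such that $$\mathbb{P}\left(\left\Vert\boldsymbol{\Theta}^*-\widehat{\boldsymbol{\Theta}}^{VAR}\right\Vert_2^2\le C_{\boldsymbol{Q}^0}\,\rho_n\left(k^2+n\log(k)\right)\right)\to1\quad\text{when } n\to\infty.$$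
   Context: The number of communities $k$ is fixed. $a_n\gg b_n$ means $a_n/b_n\to\infty$. $\mathcal{Z}_{n,k}$ is the set of label functions $z:[n]\to[k]$. $\Vert\boldsymbol{M}\Vert_2^2=\sum_{i<j}\boldsymbol{M}_{ij}^2$. Stochastic block model with random labels and parameters $(\alpha,\boldsymbol{Q})$: labels $z^*(1),\dots,z^*(n)$ are i.i.d. with $\mathbb{P}(z^*(i)=a)=\alpha_a$; conditionally on $z^*$, $\boldsymbol{A}$ is symmetric with zero diagonal and independent entries $\boldsymbol{A}_{ij}\sim$ Bernoulli$(\boldsymbol{Q}_{z^*(i)z^*(j)})$, $i<j$. All entries of $\boldsymbol{A}$ are observed. The matrix of connection probabilities is $\boldsymbol{\Theta}^*_{ij}=\boldsymbol{Q}^*_{z^*(i)z^*(j)}$ for $i\neq j$, $\boldsymbol{\Theta}^*_{ii}=0$. $\mathcal{Q}$ is the set of parameters $(\alpha,\boldsymbol{Q})$ of the form (A1)–(A2): $\alpha$ is a probability vector with positive entries and $\boldsymbol{Q}=\rho\,\boldsymbol{Q}'\in(0,1)^{k\times k}_{\rm sym}$ with $\rho>0$, $\boldsymbol{Q}'$ symmetric with positive entries and $\sum_{a,b}\alpha_a\alpha_b\boldsymbol{Q}'_{ab}=1$. Likelihoods: $\mathcal{L}(\boldsymbol{A};z,\boldsymbol{Q})=\sum_{i<j}\left(\boldsymbol{A}_{ij}\log\boldsymbol{Q}_{z(i)z(j)}+(1-\boldsymbol{A}_{ij})\log(1-\boldsymbol{Q}_{z(i)z(j)})\right)$ and $\mathfrak{l}(\boldsymbol{A};\alpha,\boldsymbol{Q})=\sum_{z\in\mathcal{Z}_{n,k}}\left(\prod_{i\le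 n}\alpha_{z(i)}\right)\exp(\mathcal{L}(\boldsymbol{A};z,\boldsymbol{Q}))$. The posterior of the labels is $\mathbb{P}(z|\boldsymbol{A},\alpha,\boldsymbol{Q})=\left(\prod_i\alpha_{z(i)}\right)\exp(\mathcal{L}(\boldsymbol{A};z,\boldsymbol{Q}))/\mathfrak{l}(\boldsymbol{A};\alpha,\boldsymbol{Q})$. Variational label estimator: $\mathcal{T}$ is the set of $\tau=(\tau^1,\dots,\tau^n)$ with each $\tau^i=(\tau^i_1,\dots,\tau^i_k)$ a probability vector, and $\mathbb{P}_\tau(z)=\prod_{i\le n}\tau^i_{z(i)}$. With $KL(\cdot\Vert\cdot)$ the Kullback-Leibler divergence, $$\mathcal{J}(\boldsymbol{A};\tau,\alpha,\boldsymbol{Q})=\log\mathfrak{l}(\boldsymbol{A};\alpha,\boldsymbol{Q})-KL\left(\mathbb{P}_\tau(\cdot)\,\Vert\,\mathbb{P}(\cdot|\boldsymbol{A},\alpha,\boldsymbol{Q})\right),$$ $(\widehat\alpha^{VAR},\widehat{\boldsymbol{Q}}^{VAR},\widehat\tau^{VAR})\in\arg\max_{(\alpha,\boldsymbol{Q})\in\mathcal{Q},\,\tau\in\mathcal{T}}\mathcal{J}(\boldsymbol{A};\tau,\alpha,\boldsymbol{Q})$, and $\widehat z^{VAR}(i)=\arg\max_{a\le k}(\widehat\tau^{VAR})^i_a$ for $i\le n$. Variational estimator of connection probabilities: with $\widehat z=\widehat z^{VAR}$, let $n_{ab}=|\widehat z^{-1}(a)|\,|\widehat z^{-1}(b)|$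 if $a\ne b$ and $n_{aa}=|\widehat z^{-1}(a)|(|\widehat z^{-1}(a)|-1)$, and $$\widehat{\boldsymbol{Q}}^{ML-VAR}_{ab}=\frac{1}{n_{ab}}\sum_{i\in\widehat z^{-1}(a),\,j\in\widehat z^{-1}(b)}\boldsymbol{A}_{ij}.$$ Then $\widehat{\boldsymbol{\Theta}}^{VAR}_{ij}=\widehat{\boldsymbol{Q}}^{ML-VAR}_{\widehat z^{VAR}(i)\,\widehat z^{VAR}(j)}$ for $i\ne j$ and $\widehat{\boldsymbol{\Theta}}^{VAR}_{ii}=0$.
   Formalization: The number of communities k is assumed to be at least 2; for k = 1 the claim fails, since log(k) = 0 makes the bound a multiple of ρ_n while the squared error divided by ρ_n converges in law to a chi-square variable when ρ_n tends to 0. *)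

theory Defs
  imports "HOL-Probability.Probability"
begin

text \<open>
  The communities are the elements of a finite type \<open>'k\<close> and the nodes are \<open>0, \<dots>, n - 1\<close>.
  Node-indexed objects are functions on \<open>nat\<close>; only their values below \<open>n\<close> matter.
\<close>

definition prob_vector :: "real ^ 'k \<Rightarrow> bool" where
  "prob_vector p \<longleftrightarrow> (\<forall>a. 0 \<le> p $ a) \<and> (\<Sum>a\<in>UNIV. p $ a) = 1"

definition normalized :: "real ^ 'k \<Rightarrow> real ^ 'k ^ 'k \<Rightarrow> bool" where
  "normalized \<alpha> Q \<longleftrightarrow> (\<Sum>a\<in>UNIV. \<Sum>b\<in>UNIV. \<alpha> $ a * \<alpha> $ b * Q $ a $ b) = 1"

definition sbm_params :: "((real ^ 'k) \<times> (real ^ 'k ^ 'k)) set" where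
  "sbm_params = {(\<alpha>, Q). prob_vector \<alpha> \<and> (\<forall>a. 0 < \<alpha> $ a) \<and>
     (\<forall>a b. 0 < Q $ a $ b \<and> Q $ a $ b < 1) \<and>
     (\<exists>\<rho> Q'. 0 < \<rho> \<and> Q = \<rho> *\<^sub>R Q' \<and> transpose Q' = Q' \<and>
        (\<forall>a b. 0 < Q' $ a $ b) \<and> normalized \<alpha> Q')}"

definition labelings :: "nat \<Rightarrow> (nat \<Rightarrow> 'k) set" where
  "labelings n = {..<n} \<rightarrow>\<^sub>E UNIV"

definition node_pairs :: "nat \<Rightarrow> (nat \<times> nat) set" where
  "node_pairs n = {(i, j). i < j \<and> j < n}"

definition vec_pmf :: "real ^ 'k \<Rightarrow> 'k pmf" where
  "vec_pmf p = embed_pmf (($) p)"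

text \<open>
  The labels are \<open>undefined\<close> outside \<open>{..<n}\<close>, so that the following distributions are
  concentrated on \<^term>\<open>labelings n\<close>.
\<close>

definition product_labels :: "nat \<Rightarrow> (nat \<Rightarrow> real ^ 'k) \<Rightarrow> (nat \<Rightarrow> 'k) pmf" where
  "product_labels n \<tau> = Pi_pmf {..<n} undefined (\<lambda>i. vec_pmf (\<tau> i))"

text \<open>
  The symmetric 0-1 matrix with entries \<open>e (i, j)\<close> for \<open>i < j\<close>. Its diagonal vanishes
  for the \<open>e\<close> used below, which are \<open>False\<close> outside \<^term>\<open>node_pairs n\<close>.
\<close>

definition adjacency :: "(nat \<times> nat \<Rightarrow> bool) \<Rightarrow> nat \<Rightarrow> nat \<Rightarrow> real" where
  "adjacency e i j = of_bool (e (min i j, max i j))"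

text \<open>The joint distribution of the labels and of the adjacency matrix.\<close>

definition sbm :: "nat \<Rightarrow> real ^ 'k \<Rightarrow> real ^ 'k ^ 'k \<Rightarrow> ((nat \<Rightarrow> 'k) \<times> (nat \<Rightarrow> nat \<Rightarrow> real)) pmf" where
  "sbm n \<alpha> Q =
     bind_pmf (product_labels n (\<lambda>_. \<alpha>)) (\<lambda>z.
       map_pmf (\<lambda>e. (z, adjacency e))
         (Pi_pmf (node_pairs n) False (\<lambda>(i, j). bernoulli_pmf (Q $ z i $ z j))))"

definition conn_probs :: "(nat \<Rightarrow> 'k) \<Rightarrow> real ^ 'k ^ 'k \<Rightarrow> nat \<Rightarrow> nat \<Rightarrow> real" where
  "conn_probs z Q i j = (if i = j then 0 else Q $ z i $ z j)"

definition sq_norm :: "nat \<Rightarrow> (nat \<Rightarrow> nat \<Rightarrow> real) \<Rightarrow> real" where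
  "sq_norm n M = (\<Sum>(i, j)\<in>node_pairs n. (M i j)\<^sup>2)"

definition log_lik :: "nat \<Rightarrow> (nat \<Rightarrow> nat \<Rightarrow> real) \<Rightarrow> (nat \<Rightarrow> 'k) \<Rightarrow> real ^ 'k ^ 'k \<Rightarrow> real" where
  "log_lik n A z Q =
     (\<Sum>(i, j)\<in>node_pairs n.
        A i j * ln (Q $ z i $ z j) + (1 - A i j) * ln (1 - Q $ z i $ z j))"

definition joint_weight ::
    "nat \<Rightarrow> (nat \<Rightarrow> nat \<Rightarrow> real) \<Rightarrow> real ^ 'k \<Rightarrow> real ^ 'k ^ 'k \<Rightarrow> (nat \<Rightarrow> 'k) \<Rightarrow> real" where
  "joint_weight n A \<alpha> Q z = (\<Prod>i<n. \<alpha> $ z i) * exp (log_lik n A z Q)"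

definition marginal_lik ::
    "nat \<Rightarrow> (nat \<Rightarrow> nat \<Rightarrow> real) \<Rightarrow> real ^ 'k \<Rightarrow> real ^ 'k ^ 'k \<Rightarrow> real" where
  "marginal_lik n A \<alpha> Q = (\<Sum>z\<in>labelings n. joint_weight n A \<alpha> Q z)"

definition posterior ::
    "nat \<Rightarrow> (nat \<Rightarrow> nat \<Rightarrow> real) \<Rightarrow> real ^ 'k \<Rightarrow> real ^ 'k ^ 'k \<Rightarrow> (nat \<Rightarrow> 'k) pmf" where
  "posterior n A \<alpha> Q =
     embed_pmf (\<lambda>z. if z \<in> labelings n then joint_weight n A \<alpha> Q z / marginal_lik n A \<alpha> Q else 0)"

text \<open>
  \<^const>\<open>KL_divergence\<close> takes the base of the logarithm and then the reference measure:
  \<^term>\<open>KL_divergence (exp 1) M N\<close> is the divergence of \<open>N\<close> from \<open>M\<close>, i.e.\ \<open>KL(N \<parallel> M)\<close>.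
\<close>

definition var_objective ::
    "nat \<Rightarrow> (nat \<Rightarrow> nat \<Rightarrow> real) \<Rightarrow> (nat \<Rightarrow> real ^ 'k) \<Rightarrow> real ^ 'k \<Rightarrow> real ^ 'k ^ 'k \<Rightarrow> real" where
  "var_objective n A \<tau> \<alpha> Q =
     ln (marginal_lik n A \<alpha> Q) -
     KL_divergence (exp 1) (measure_pmf (posterior n A \<alpha> Q)) (measure_pmf (product_labels n \<tau>))"

definition var_params :: "nat \<Rightarrow> (nat \<Rightarrow> real ^ 'k) set" where
  "var_params n = {..<n} \<rightarrow>\<^sub>E {p. prob_vector p}"

definition is_var_estimate ::
    "nat \<Rightarrow> (nat \<Rightarrow> nat \<Rightarrow> real) \<Rightarrow>
      (real ^ 'k) \<times> (real ^ 'k ^ 'k) \<times> (nat \<Rightarrow> real ^ 'k) \<Rightarrow> bool" where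
  "is_var_estimate n A =
     is_arg_max (\<lambda>(\<alpha>, Q, \<tau>). var_objective n A \<tau> \<alpha> Q)
       (\<lambda>(\<alpha>, Q, \<tau>). (\<alpha>, Q) \<in> sbm_params \<and> \<tau> \<in> var_params n)"

text \<open>Ties are broken arbitrarily.\<close>

definition is_var_labeling ::
    "nat \<Rightarrow> (nat \<Rightarrow> nat \<Rightarrow> real) \<Rightarrow> (nat \<Rightarrow> 'k::finite) \<Rightarrow> bool" where
  "is_var_labeling n A z \<longleftrightarrow>
     z \<in> labelings n \<and>
     (\<exists>\<alpha> Q \<tau>. is_var_estimate n A (\<alpha>, Q, \<tau>) \<and>
        (\<forall>i<n. is_arg_max (($) (\<tau> i)) (\<lambda>_. True) (z i)))"

definition block :: "nat \<Rightarrow> (nat \<Rightarrow> 'k) \<Rightarrow> 'k \<Rightarrow> nat set" where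
  "block n z a = {i. i < n \<and> z i = a}"

definition block_count :: "nat \<Rightarrow> (nat \<Rightarrow> 'k) \<Rightarrow> 'k \<Rightarrow> 'k \<Rightarrow> real" where
  "block_count n z a b =
     (if a = b then real (card (block n z a)) * (real (card (block n z a)) - 1)
      else real (card (block n z a)) * real (card (block n z b)))"

text \<open>
  Entries with \<^term>\<open>block_count n z a b = 0\<close> get the value 0 by the convention for division;
  no off-diagonal entry of the connection matrix refers to them.
\<close>

definition block_means ::
    "nat \<Rightarrow> (nat \<Rightarrow> nat \<Rightarrow> real) \<Rightarrow> (nat \<Rightarrow> 'k) \<Rightarrow> real ^ 'k ^ 'k" where
  "block_means n A z =
     (\<chi> a b. (\<Sum>i\<in>block n z a. \<Sum>j\<in>block n z b. A i j) / block_count n z a b)"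

definition var_conn_probs ::
    "nat \<Rightarrow> (nat \<Rightarrow> nat \<Rightarrow> real) \<Rightarrow> (nat \<Rightarrow> 'k::finite) \<Rightarrow> nat \<Rightarrow> nat \<Rightarrow> real" where
  "var_conn_probs n A z = conn_probs z (block_means n A z)"

text \<open>On the parameter set, \<^const>\<open>embed_pmf\<close> is applied to genuine probability mass functions.\<close>

lemma pmf_vec_pmf:
  assumes "prob_vector p" shows "pmf (vec_pmf p) a = p $ a"
  unfolding vec_pmf_def using assms
  by (subst pmf_embed_pmf) (auto simp: prob_vector_def nn_integral_count_space_finite)

lemma finite_labelings: "finite (labelings n :: (nat \<Rightarrow> 'k::finite) set)"
  by (auto simp: labelings_def intro!: finite_PiE)

lemma labelings_nonempty: "(labelings n :: (nat \<Rightarrow> 'k::finite) set) \<noteq> {}"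
  by (auto simp: labelings_def PiE_eq_empty_iff)

lemma joint_weight_pos: "\<forall>a. 0 < \<alpha> $ a \<Longrightarrow> 0 < joint_weight n A \<alpha> Q z"
  by (auto simp: joint_weight_def intro!: mult_pos_pos prod_pos)

lemma marginal_lik_pos: "\<forall>a. 0 < \<alpha> $ a \<Longrightarrow> 0 < marginal_lik n A \<alpha> Q"
  unfolding marginal_lik_def by (intro sum_pos finite_labelings labelings_nonempty joint_weight_pos)

lemma pmf_posterior:
  fixes z :: "nat \<Rightarrow> 'k::finite"
  assumes "\<forall>a. 0 < \<alpha> $ a"
  shows "pmf (posterior n A \<alpha> Q) z =
    (if z \<in> labelings n then joint_weight n A \<alpha> Q z / marginal_lik n A \<alpha> Q else 0)"
  unfolding posterior_def
proof (rule pmf_embed_pmf)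
  fix z :: "nat \<Rightarrow> 'k"
  show "0 \<le> (if z \<in> labelings n then joint_weight n A \<alpha> Q z / marginal_lik n A \<alpha> Q else 0)"
    using joint_weight_pos[OF assms, of n A Q z] marginal_lik_pos[OF assms, of n A Q] by auto
next
  let ?f = "\<lambda>z::nat \<Rightarrow> 'k. if z \<in> labelings n then joint_weight n A \<alpha> Q z / marginal_lik n A \<alpha> Q else 0"
  have "(\<integral>\<^sup>+z. ennreal (?f z) \<partial>count_space UNIV) = (\<Sum>z\<in>labelings n. ennreal (?f z))"
    by (rule nn_integral_count_space'[OF finite_labelings]) auto
  also have "\<dots> = ennreal (\<Sum>z\<in>labelings n. ?f z)"
    using joint_weight_pos[OF assms, of n A Q] marginal_lik_pos[OF assms, of n A Q]
    by (intro sum_ennreal) (auto intro!: divide_nonneg_pos less_imp_le)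
  also have "(\<Sum>z\<in>labelings n. ?f z) = 1"
    using marginal_lik_pos[OF assms, of n A Q]
    by (simp add: sum_divide_distrib[symmetric] marginal_lik_def[symmetric])
  finally show "(\<integral>\<^sup>+z. ennreal (?f z) \<partial>count_space UNIV) = 1" by simp
qed

lemma pmf_product_labels:
  assumes "\<tau> \<in> var_params n" "z \<in> labelings n"
  shows "pmf (product_labels n \<tau>) z = (\<Prod>i<n. \<tau> i $ z i)"
proof -
  have "\<And>i. i < n \<Longrightarrow> prob_vector (\<tau> i)" using assms(1) by (auto simp: var_params_def)
  then show ?thesis using assms(2)
    unfolding product_labels_def
    by (subst pmf_Pi) (auto simp: labelings_def pmf_vec_pmf PiE_def extensional_def intro!: prod.cong)
qed

lemma set_product_labels_subset: "set_pmf (product_labels n \<tau>) \<subseteq> labelings n"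
  unfolding product_labels_def labelings_def
  using set_Pi_pmf_subset'[of "{..<n}" undefined "\<lambda>i. vec_pmf (\<tau> i)"]
  by (auto simp: PiE_def extensional_def PiE_dflt_def)

lemma KL_product_labels_posterior:
  fixes \<tau> :: "nat \<Rightarrow> real ^ 'k::finite"
  assumes "\<forall>a. 0 < \<alpha> $ a"
  shows "KL_divergence (exp 1) (measure_pmf (posterior n A \<alpha> Q)) (measure_pmf (product_labels n \<tau>))
   = (\<Sum>z\<in>labelings n. pmf (product_labels n \<tau>) z * ln (pmf (product_labels n \<tau>) z / pmf (posterior n A \<alpha> Q) z))"
proof -
  let ?p = "product_labels n \<tau>" and ?q = "posterior n A \<alpha> Q"
  interpret sf: sigma_finite_measure "count_space (labelings n :: (nat \<Rightarrow> 'k) set)"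
    by (rule sigma_finite_measure_count_space_finite[OF finite_labelings])
  have pos: "0 < pmf ?q z" if "z \<in> labelings n" for z
    using that joint_weight_pos[OF assms, of n A Q z] marginal_lik_pos[OF assms, of n A Q] by (simp add: pmf_posterior[OF assms])
  have d: "measure_pmf ?p = density (measure_pmf ?q) (\<lambda>z. ennreal (pmf ?p z / pmf ?q z))"
  proof (rule measure_eqI)
    fix X
    have "emeasure (density (measure_pmf ?q) (\<lambda>z. ennreal (pmf ?p z / pmf ?q z))) X =
      (\<integral>\<^sup>+z. ennreal (pmf ?p z / pmf ?q z) * indicator X z \<partial>measure_pmf ?q)"
      by (simp add: emeasure_density)
    also have "\<dots> = (\<integral>\<^sup>+z. ennreal (pmf ?q z) * (ennreal (pmf ?p z / pmf ?q z) * indicator X z) \<partial>count_space UNIV)"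
      by (simp add: nn_integral_measure_pmf)
    also have "\<dots> = (\<integral>\<^sup>+z. ennreal (pmf ?p z) * indicator X z \<partial>count_space UNIV)"
    proof (rule nn_integral_cong)
      fix z show "ennreal (pmf ?q z) * (ennreal (pmf ?p z / pmf ?q z) * indicator X z) = ennreal (pmf ?p z) * indicator X z"
      proof (cases "z \<in> labelings n")
        case True with pos[OF this] show ?thesis
          by (simp add: mult.assoc[symmetric] ennreal_mult'[symmetric])
      next
        case False
        then have "pmf ?p z = 0" using set_product_labels_subset[of n \<tau>] by (auto simp: set_pmf_iff)
        then show ?thesis by simp
      qed
    qed
    also have "\<dots> = emeasure (measure_pmf ?p) X"
      by (simp add: nn_integral_measure_pmf[symmetric])
    finally show "emeasure (measure_pmf ?p) X = emeasure (density (measure_pmf ?q) (\<lambda>z. ennreal (pmf ?p z / pmf ?q z))) X" by simp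
  qed simp
  have "KL_divergence (exp 1) (measure_pmf ?q) (measure_pmf ?p) =
     (\<integral>z. (pmf ?p z / pmf ?q z) * log (exp 1) (pmf ?p z / pmf ?q z) \<partial>measure_pmf ?q)"
    unfolding d using pos by (intro sigma_finite_measure.KL_density prob_space_imp_sigma_finite measure_pmf.prob_space_axioms) auto
  also have "\<dots> = (\<Sum>z\<in>labelings n. (pmf ?p z / pmf ?q z) * log (exp 1) (pmf ?p z / pmf ?q z) * pmf ?q z)"
    by (rule integral_measure_pmf_real[OF finite_labelings]) (auto simp: set_pmf_iff pmf_posterior[OF assms] split: if_splits)
  also have "\<dots> = (\<Sum>z\<in>labelings n. pmf ?p z * ln (pmf ?p z / pmf ?q z))"
    using pos by (intro sum.cong) (auto simp: log_def less_imp_neq[symmetric] dest!: pos)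
  finally show ?thesis .
qed
end

theory Submission
  imports Defs
begin

text \<open>
  The proof compares connection matrices, not labels: likelihood considerations alone show that the
  estimated labeling fits the true connection matrix as well as the theorem claims. Let
  \<open>R\<close> be an upper bound of order \<open>\<rho>\<^sub>n\<close> for the true connection probabilities \<open>\<Theta>\<close>, and let
  \<open>\<Theta>(z, Q)\<close> be the matrix with entries \<open>min R (Q $ z i $ z j)\<close>.

  The variational estimate is at least as good as the point mass at the true labels, combined with the
  true \<open>Q\<close> and uniform class probabilities. So the log-likelihood of \<open>(z, Q)\<close>, with \<open>Q\<close>
  estimated and \<open>z\<close> averaged over the mean-field law, falls short of the true one by at most \<open>n ln k\<close>
  (\<open>var_estimate_expected_log_lik\<close>). On the other hand the mean of the square root of a likelihood ratio
  is a Hellinger affinity, hence at most \<open>exp (- \<parallel>\<Theta>(z, Q) - \<Theta>\<parallel>\<^sup>2 / (8 R))\<close>. By Markov's inequality and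
  a union bound over the \<open>k\<^sup>n\<close> labelings and polynomially many \<open>Q\<close>, with high probability the
  likelihood loses a multiple of \<open>\<parallel>\<Theta>(z, Q) - \<Theta>\<parallel>\<^sup>2 / R\<close>, up to a term of order \<open>n\<close>, for all \<open>z\<close> and \<open>Q\<close>
  simultaneously (\<open>likelihood_ratio_tail_uniform\<close>). Together, the mean-field average of
  \<open>\<parallel>\<Theta>(z, Q) - \<Theta>\<parallel>\<^sup>2\<close> is of order \<open>R n\<close>.

  Under a product law a pair of nodes gets its pair of modal labels with probability at least
  \<open>1/k\<^sup>2\<close>. Since the squared norm is a sum over pairs, the bound passes to the modal labeling at the
  cost of a factor \<open>k\<^sup>2\<close> (\<open>sq_norm_mode_le\<close>).

  Replacing the estimated \<open>Q\<close> by block means of the adjacency matrix is an orthogonal projection. It adds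
  for each block only \<open>W\<^sup>2 / N\<close>, with \<open>W\<close> the sum of the noise over the \<open>N\<close> pairs of the block
  (\<open>sum_sq_dev_average_le\<close>). Chernoff's inequality and a union bound over labelings give
  \<open>W\<^sup>2 / N\<close> of order \<open>R n\<close>, provided that \<open>N R\<close> is at least of order \<open>n\<close> (\<open>noise_tail_uniform\<close>).

  This proviso is where the columns of \<open>Q\<^sub>0\<close> have to be distinct. If an estimated class were small, two
  true classes would have linearly many nodes in a common estimated class, and one entry of \<open>Q\<close> would
  have to fit two values at distance of order \<open>\<rho>\<^sub>n\<close> on order \<open>n\<^sup>2\<close> pairs. The misfit, of order
  \<open>\<rho>\<^sub>n\<^sup>2 n\<^sup>2\<close>, exceeds \<open>R n\<close> because \<open>\<rho>\<^sub>n n\<close> tends to infinity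
  (\<open>blocks_large_if_close\<close>). So all estimated classes have linear size, \<open>N\<close> is of order \<open>n\<^sup>2\<close>, and
  \<open>N R\<close> dominates \<open>n\<close>.
\<close>

section \<open>Tail bounds for product distributions\<close>

lemma exp_le_quadratic:
  fixes x :: real
  assumes "\<bar>x\<bar> \<le> 1"
  shows "exp x \<le> 1 + x + x\<^sup>2"
proof (cases "0 \<le> x")
  case True
  then show ?thesis using assms exp_bound[of x] by simp
next
  case False
  define y where "y = - x"
  have y: "0 < y" "y \<le> 1" using False assms by (auto simp: y_def)
  have "1 \<le> 1 + y^2 / 2 + y^3 / 2 + y^4 / 2" using y by simp
  also have "\<dots> = (1 - y + y\<^sup>2) * (1 + y + y\<^sup>2 / 2)"
    by (simp add: field_simps power2_eq_square power3_eq_cube power4_eq_xxxx)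
  also have "\<dots> \<le> (1 - y + y\<^sup>2) * exp y"
  proof (rule mult_left_mono)
    show "1 + y + y\<^sup>2 / 2 \<le> exp y" using exp_lower_Taylor_quadratic[of y] y by simp
    have "0 \<le> 1 - y" "0 \<le> y\<^sup>2" using y by auto
    then show "0 \<le> 1 - y + y\<^sup>2" by simp
  qed
  finally show ?thesis
    unfolding y_def by (simp add: exp_minus field_simps)
qed

text \<open>
  All concentration in this proof is of this one kind. The compensator that keeps each exponential
  moment below 1 is part of \<open>f\<close>, so the moments multiply to at most 1 whatever the index set.
\<close>

lemma Pi_pmf_exp_Markov:
  fixes f :: "'i \<Rightarrow> 'a \<Rightarrow> real"
  assumes "finite I" "\<And>i. i \<in> I \<Longrightarrow> finite (set_pmf (p i))"
    and "\<And>i. i \<in> I \<Longrightarrow> measure_pmf.expectation (p i) (\<lambda>x. exp (f i x)) \<le> 1"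
  shows "measure_pmf.prob (Pi_pmf I d p) {x. t \<le> (\<Sum>i\<in>I. f i (x i))} \<le> exp (- t)"
proof -
  let ?P = "Pi_pmf I d p"
  let ?F = "\<lambda>x. \<Prod>i\<in>I. exp (f i (x i))"
  have fin: "finite (set_pmf ?P)"
    unfolding set_Pi_pmf[OF assms(1)] by (rule finite_PiE_dflt) (use assms in auto)
  have "measure_pmf.expectation ?P ?F =
      (\<Prod>i\<in>I. measure_pmf.expectation (p i) (\<lambda>x. exp (f i x)))"
    using assms by (intro expectation_prod_Pi_pmf) (auto intro: integrable_measure_pmf_finite)
  also have "\<dots> \<le> 1"
    by (rule prod_le_1) (use assms in \<open>auto intro!: integral_nonneg\<close>)
  finally have E: "measure_pmf.expectation ?P ?F \<le> 1" .
  have "measure_pmf.prob ?P {x. t \<le> (\<Sum>i\<in>I. f i (x i))} =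
      measure_pmf.prob ?P {x \<in> space (measure_pmf ?P). exp t \<le> ?F x}"
    using assms(1) by (simp add: exp_sum[symmetric])
  also have "\<dots> \<le> measure_pmf.expectation ?P ?F / exp t"
    by (rule integral_Markov_inequality_measure)
      (auto intro!: integrable_measure_pmf_finite fin prod_nonneg)
  also have "\<dots> \<le> 1 / exp t" using E by (intro divide_right_mono) auto
  finally show ?thesis by (simp add: exp_minus field_simps)
qed

lemma prob_Ex_le_card:
  assumes "finite F" "\<And>y. y \<in> F \<Longrightarrow> measure_pmf.prob p {x. P x y} \<le> c"
  shows "measure_pmf.prob p {x. \<exists>y\<in>F. P x y} \<le> real (card F) * c"
proof -
  have "{x. \<exists>y\<in>F. P x y} = (\<Union>y\<in>F. {x. P x y})" by auto
  then have "measure_pmf.prob p {x. \<exists>y\<in>F. P x y} \<le> (\<Sum>y\<in>F. measure_pmf.prob p {x. P x y})"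
    using assms(1) by (simp add: measure_pmf.finite_measure_subadditive_finite)
  also have "\<dots> \<le> (\<Sum>y\<in>F. c)" by (rule sum_mono) (rule assms)
  finally show ?thesis by simp
qed

text \<open>
  For conditioning on the labels: atypical values, those in \<open>B\<close>, are given up, and for the other ones
  the conditional probability is bounded uniformly.
\<close>

lemma measure_bind_pmf_le:
  assumes "\<And>x. x \<in> set_pmf p \<Longrightarrow> x \<notin> B \<Longrightarrow> measure_pmf.prob (f x) S \<le> c" "0 \<le> c"
  shows "measure_pmf.prob (bind_pmf p f) S \<le> measure_pmf.prob p B + c"
proof -
  have "emeasure (measure_pmf (bind_pmf p f)) S = (\<integral>\<^sup>+x. emeasure (f x) S \<partial>p)" by simp
  also have "\<dots> \<le> (\<integral>\<^sup>+x. indicator B x + ennreal c \<partial>p)"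
  proof (rule nn_integral_mono_AE, rule AE_pmfI)
    fix x assume x: "x \<in> set_pmf p"
    have "measure_pmf.prob (f x) S \<le> indicator B x + c"
      using assms(1)[OF x] assms(2) measure_pmf.prob_le_1[of "f x" S]
      by (cases "x \<in> B") (auto intro: order_trans)
    then have "ennreal (measure_pmf.prob (f x) S) \<le> ennreal (indicator B x + c)"
      by (rule ennreal_leI)
    then show "emeasure (f x) S \<le> indicator B x + ennreal c"
      using assms(2) by (simp add: measure_pmf.emeasure_eq_measure ennreal_indicator ennreal_plus)
  qed
  also have "\<dots> = ennreal (measure_pmf.prob p B + c)"
    by (subst nn_integral_add) (auto simp: measure_pmf.emeasure_eq_measure assms(2))
  finally show ?thesis
    using assms(2) by (simp add: measure_pmf.emeasure_eq_measure flip: ennreal_plus)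
qed

section \<open>The likelihood ratio controls the distance of connection matrices\<close>

definition bern_log_lik :: "real \<Rightarrow> bool \<Rightarrow> real" where
  "bern_log_lik q x = (if x then ln q else ln (1 - q))"

text \<open>
  The affinity of two Bernoulli laws is 1 minus half the sum of \<open>(sqrt q - sqrt \<theta>)\<^sup>2\<close> and
  the same square for \<open>1 - q\<close>, \<open>1 - \<theta>\<close>. The first square alone gives the bound, because
  \<open>\<bar>q - \<theta>\<bar> \<le> 2 sqrt R \<bar>sqrt q - sqrt \<theta>\<bar>\<close> for \<open>q, \<theta> \<le> R\<close>. Truncating \<open>q\<close> at \<open>R\<close> covers large
  \<open>q\<close>, for which no bound by the untruncated squared difference over \<open>R\<close> can hold uniformly; it is
  harmless later, since truncation at an upper bound of \<open>\<theta>\<close> never moves \<open>q\<close> away from \<open>\<theta>\<close>.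
\<close>

lemma Hellinger_affinity_le:
  fixes q \<theta> R :: real
  assumes q: "0 < q" "q < 1" and th: "0 < \<theta>" "\<theta> < 1" "\<theta> \<le> R"
  shows "sqrt (q * \<theta>) + sqrt ((1 - q) * (1 - \<theta>)) \<le> 1 - (min R q - \<theta>)\<^sup>2 / (8 * R)"
proof -
  have R: "0 < R" using th by simp
  define a b where "a = sqrt q" and "b = sqrt \<theta>"
  define m where "m = sqrt (min R q)"
  have ab: "0 < a" "0 < b" "a\<^sup>2 = q" "b\<^sup>2 = \<theta>" using q th by (auto simp: a_def b_def)
  have m: "0 < m" "m\<^sup>2 = min R q" "m \<le> sqrt R" "m \<le> a" "a \<noteq> m \<Longrightarrow> b \<le> m"
    using q th R by (auto simp: m_def a_def b_def min_def)
  have bR: "b \<le> sqrt R" using th by (simp add: b_def)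
  have "(1 - q) * (1 - \<theta>) \<le> (((1 - q) + (1 - \<theta>)) / 2)\<^sup>2"
    using sum_squares_bound[of "1-q" "1-\<theta>"] by (simp add: power2_eq_square field_simps)
  then have s2: "sqrt ((1 - q) * (1 - \<theta>)) \<le> ((1 - q) + (1 - \<theta>)) / 2"
    using q th by (intro real_le_lsqrt) auto
  have s1: "sqrt (q * \<theta>) = a * b" by (simp add: a_def b_def real_sqrt_mult)
  have "(min R q - \<theta>)\<^sup>2 = (m - b)\<^sup>2 * (m + b)\<^sup>2"
    unfolding m(2)[symmetric] ab(4)[symmetric] by (simp add: power_mult_distrib[symmetric] algebra_simps power2_eq_square)
  also have "\<dots> \<le> (m - b)\<^sup>2 * (2 * sqrt R)\<^sup>2"
    using m ab bR by (intro mult_left_mono power_mono) auto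
  also have "\<dots> = (m - b)\<^sup>2 * (4 * R)" using R by (simp add: power_mult_distrib)
  also have "\<dots> \<le> (a - b)\<^sup>2 * (4 * R)"
  proof (rule mult_right_mono)
    show "(m - b)\<^sup>2 \<le> (a - b)\<^sup>2"
      using m(4,5) by (cases "a = m") (auto intro!: power_mono)
  qed (use R in simp)
  finally have "(min R q - \<theta>)\<^sup>2 / (8 * R) \<le> (a - b)\<^sup>2 / 2"
    using R by (simp add: field_simps)
  moreover have "(a - b)\<^sup>2 / 2 = q / 2 + \<theta> / 2 - a * b"
    unfolding ab(3,4)[symmetric] by (simp add: power2_eq_square field_simps)
  ultimately show ?thesis using s1 s2 by (simp add: field_simps)
qed

text \<open>
  Taking the square root of the likelihood ratio turns its mean, which is 1 and says nothing,
  into the Hellinger affinity. This works for every \<open>q\<close> in \<open>(0,1)\<close>, although \<open>ln q\<close> and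
  \<open>ln (1 - q)\<close> are unbounded.
\<close>

lemma bern_half_likelihood_ratio:
  fixes q \<theta> R :: real
  assumes q: "0 < q" "q < 1" and th: "0 < \<theta>" "\<theta> < 1" "\<theta> \<le> R"
  shows "measure_pmf.expectation (bernoulli_pmf \<theta>)
     (\<lambda>x. exp ((bern_log_lik q x - bern_log_lik \<theta> x) / 2 + (min R q - \<theta>)\<^sup>2 / (8 * R))) \<le> 1"
proof -
  let ?h = "(min R q - \<theta>)\<^sup>2 / (8 * R)"
  have half: "exp (ln x / 2) = sqrt x" if "0 < x" for x :: real
    using that by (simp add: ln_sqrt[symmetric])
  have *: "exp ((ln x - ln y) / 2) * y = sqrt (x * y)" if "0 < x" "0 < y" for x y :: real
  proof -
    have "exp ((ln x - ln y) / 2) = sqrt x / sqrt y"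
      using that by (simp add: diff_divide_distrib exp_diff half)
    then show ?thesis using that real_div_sqrt[of y] by (simp add: real_sqrt_mult times_divide_eq_right[symmetric] del: times_divide_eq_right)
  qed
  let ?X = "exp ((ln q - ln \<theta>) / 2)" and ?Y = "exp ((ln (1 - q) - ln (1 - \<theta>)) / 2)"
  have "measure_pmf.expectation (bernoulli_pmf \<theta>)
      (\<lambda>x. exp ((bern_log_lik q x - bern_log_lik \<theta> x) / 2 + ?h)) =
    (?X * \<theta> + ?Y * (1 - \<theta>)) * exp ?h"
    using th by (simp add: bern_log_lik_def exp_add distrib_right mult.assoc mult.commute[of "exp ?h"])
  also have "?X * \<theta> + ?Y * (1 - \<theta>) = sqrt (q * \<theta>) + sqrt ((1 - q) * (1 - \<theta>))"
    using q th by (intro arg_cong2[where f = "(+)"] *) auto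
  also have "(sqrt (q * \<theta>) + sqrt ((1 - q) * (1 - \<theta>))) * exp ?h \<le> exp (- ?h) * exp ?h"
    using Hellinger_affinity_le[OF assms] exp_ge_add_one_self[of "- ?h"]
    by (intro mult_right_mono) auto
  finally show ?thesis by (simp add: exp_minus)
qed

lemma bern_centred_mgf:
  fixes \<theta> c :: real
  assumes "0 \<le> \<theta>" "\<theta> \<le> 1" "\<bar>c\<bar> \<le> 1"
  shows "measure_pmf.expectation (bernoulli_pmf \<theta>)
     (\<lambda>x. exp (c * (of_bool x - \<theta>) - c\<^sup>2 * \<theta>)) \<le> 1"
proof -
  have "measure_pmf.expectation (bernoulli_pmf \<theta>) (\<lambda>x. exp (c * (of_bool x - \<theta>) - c\<^sup>2 * \<theta>))
     = (1 + \<theta> * (exp c - 1)) * exp (- c * \<theta> - c\<^sup>2 * \<theta>)"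
    using assms by (simp add: algebra_simps exp_add[symmetric] exp_diff exp_minus) (simp add: field_simps flip: exp_add)
  also have "\<dots> \<le> exp (\<theta> * (exp c - 1)) * exp (- c * \<theta> - c\<^sup>2 * \<theta>)"
    by (intro mult_right_mono exp_ge_add_one_self) auto
  also have "\<dots> = exp (\<theta> * (exp c - 1 - c - c\<^sup>2))" by (simp add: exp_add[symmetric] algebra_simps)
  also have "\<dots> \<le> 1"
    using exp_le_quadratic[OF assms(3)] assms(1) by (simp add: mult_nonneg_nonpos)
  finally show ?thesis .
qed

text \<open>
  Chernoff's bound in the range where the variance term \<open>N R c\<^sup>2\<close> dominates. The hypothesis
  \<open>v \<le> 4 N R\<close> says exactly that the optimal exponent \<open>c\<close> does not exceed 1.
\<close>

lemma bernoulli_sum_tail: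
  fixes p :: "'i \<Rightarrow> real"
  assumes I: "finite I" "P \<subseteq> I" and p: "\<And>i. i \<in> I \<Longrightarrow> 0 \<le> p i \<and> p i \<le> 1 \<and> p i \<le> R"
    and R: "0 < R" and C: "0 \<le> v" "v \<le> 4 * real (card P) * R"
  shows "measure_pmf.prob (Pi_pmf I d (\<lambda>i. bernoulli_pmf (p i)))
     {x. v * real (card P) * R < (\<Sum>i\<in>P. of_bool (x i) - p i)\<^sup>2} \<le> 2 * exp (- v / 4)"
proof (cases "P = {}")
  case True
  then show ?thesis by simp
next
  case False
  let ?M = "Pi_pmf I d (\<lambda>i. bernoulli_pmf (p i))"
  have fP: "finite P" using I finite_subset by auto
  define N where "N = real (card P)"
  have N: "0 < N" using False fP by (simp add: N_def card_gt_0_iff)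
  define s where "s = sqrt (v * N * R)"
  have s2: "s\<^sup>2 = v * N * R" and s0: "0 \<le> s" using C N R by (auto simp: s_def)
  \<comment> \<open>the minimiser of \<open>N R c\<^sup>2 - c s\<close>\<close>
  define c where "c = s / (2 * N * R)"
  have "s\<^sup>2 \<le> (2 * N * R)\<^sup>2"
  proof -
    have "v * (N * R) \<le> (4 * N * R) * (N * R)"
      using C N R by (intro mult_right_mono) (auto simp: N_def)
    then show ?thesis unfolding s2 by (simp add: power2_eq_square algebra_simps)
  qed
  then have "s \<le> 2 * N * R" using N R by (simp add: power2_le_iff_abs_le)
  then have c: "0 \<le> c" "c \<le> 1" using s0 N R by (auto simp: c_def)
  have tail: "measure_pmf.prob ?M {x. s \<le> sg * (\<Sum>i\<in>P. of_bool (x i) - p i)} \<le> exp (- v / 4)"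
    if sg: "sg = 1 \<or> sg = -1" for sg :: real
  proof -
    define f where "f = (\<lambda>i x. if i \<in> P then sg * c * (of_bool x - p i) - (sg * c)\<^sup>2 * p i else 0)"
    have cs: "(sg * c)\<^sup>2 = c\<^sup>2" using sg by auto
    have "measure_pmf.prob ?M {x. s \<le> sg * (\<Sum>i\<in>P. of_bool (x i) - p i)} \<le>
       measure_pmf.prob ?M {x. v / 4 \<le> (\<Sum>i\<in>I. f i (x i))}"
    proof (rule measure_pmf.finite_measure_mono)
      show "{x. s \<le> sg * (\<Sum>i\<in>P. of_bool (x i) - p i)} \<subseteq> {x. v / 4 \<le> (\<Sum>i\<in>I. f i (x i))}"
      proof safe
        fix x assume x: "s \<le> sg * (\<Sum>i\<in>P. of_bool (x i) - p i)"
        have "(\<Sum>i\<in>I. f i (x i)) = (\<Sum>i\<in>P. sg * c * (of_bool (x i) - p i) - c\<^sup>2 * p i)"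
          unfolding f_def cs using I by (simp add: sum.If_cases Int_absorb1)
        also have "\<dots> = c * (sg * (\<Sum>i\<in>P. of_bool (x i) - p i)) - c\<^sup>2 * (\<Sum>i\<in>P. p i)"
          by (simp only: sum_subtractf[symmetric] sum_distrib_left mult.assoc mult.left_commute)
        also have "\<dots> \<ge> c * s - c\<^sup>2 * (N * R)"
        proof -
          have "(\<Sum>i\<in>P. p i) \<le> (\<Sum>i\<in>P. R)" by (rule sum_mono) (use p I in auto)
          then have "(\<Sum>i\<in>P. p i) \<le> N * R" by (simp add: N_def)
          then have "c\<^sup>2 * (\<Sum>i\<in>P. p i) \<le> c\<^sup>2 * (N * R)" by (intro mult_left_mono) auto
          moreover have "c * s \<le> c * (sg * (\<Sum>i\<in>P. of_bool (x i) - p i))"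
            using x c by (intro mult_left_mono) auto
          ultimately show ?thesis by linarith
        qed
        also have "c * s - c\<^sup>2 * (N * R) = s\<^sup>2 / (4 * N * R)"
          using N R by (simp add: c_def field_simps power2_eq_square)
        also have "\<dots> = v / 4" using N R by (simp add: s2)
        finally show "v / 4 \<le> (\<Sum>i\<in>I. f i (x i))" .
      qed
    qed simp
    also have "\<dots> \<le> exp (- (v / 4))"
    proof (rule Pi_pmf_exp_Markov[OF I(1)])
      fix i assume i: "i \<in> I"
      show "measure_pmf.expectation (bernoulli_pmf (p i)) (\<lambda>x. exp (f i x)) \<le> 1"
      proof (cases "i \<in> P")
        case True
        have "\<bar>sg * c\<bar> \<le> 1" using sg c by auto
        then show ?thesis using bern_centred_mgf[of "p i" "sg * c"] p[OF i] True by (simp add: f_def)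
      qed (simp add: f_def)
    qed simp
    finally show ?thesis by simp
  qed
  have "measure_pmf.prob ?M {x. v * N * R < (\<Sum>i\<in>P. of_bool (x i) - p i)\<^sup>2} \<le>
     measure_pmf.prob ?M ({x. s \<le> 1 * (\<Sum>i\<in>P. of_bool (x i) - p i)} \<union> {x. s \<le> (-1) * (\<Sum>i\<in>P. of_bool (x i) - p i)})"
  proof (rule measure_pmf.finite_measure_mono)
    have "s \<le> w \<or> s \<le> - w" if "v * N * R < w\<^sup>2" for w :: real
    proof -
      have "s < \<bar>w\<bar>" using that s2 by (intro power2_less_imp_less[of s "\<bar>w\<bar>"]) auto
      then show ?thesis by linarith
    qed
    then show "{x. v * N * R < (\<Sum>i\<in>P. of_bool (x i) - p i)\<^sup>2} \<subseteq>
      {x. s \<le> 1 * (\<Sum>i\<in>P. of_bool (x i) - p i)} \<union> {x. s \<le> (-1) * (\<Sum>i\<in>P. of_bool (x i) - p i)}"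
      by auto
  qed simp
  also have "\<dots> \<le> exp (- v / 4) + exp (- v / 4)"
    by (rule order_trans[OF measure_Un_le]) (use tail[of 1] tail[of "-1"] in auto)
  finally show ?thesis by (simp add: N_def)
qed

definition edges :: "nat \<Rightarrow> (nat \<Rightarrow> 'k) \<Rightarrow> real ^ 'k ^ 'k \<Rightarrow> (nat \<times> nat \<Rightarrow> bool) pmf" where
  "edges n z Q = Pi_pmf (node_pairs n) False (\<lambda>(i, j). bernoulli_pmf (Q $ z i $ z j))"

lemma finite_node_pairs [simp]: "finite (node_pairs n)"
  and card_node_pairs_le: "card (node_pairs n) \<le> n\<^sup>2"
proof -
  have sub: "node_pairs n \<subseteq> {..<n} \<times> {..<n}" by (auto simp: node_pairs_def)
  then show "finite (node_pairs n)" by (rule finite_subset) simp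
  show "card (node_pairs n) \<le> n\<^sup>2"
    using card_mono[OF _ sub] by (simp add: card_cartesian_product power2_eq_square)
qed

lemma adjacency_node_pairs: "(i, j) \<in> node_pairs n \<Longrightarrow> adjacency e i j = of_bool (e (i, j))"
  by (simp add: adjacency_def node_pairs_def)

lemma log_lik_adjacency:
  "log_lik n (adjacency e) z Q = (\<Sum>(i, j)\<in>node_pairs n. bern_log_lik (Q $ z i $ z j) (e (i, j)))"
  unfolding log_lik_def
  by (intro sum.cong) (auto simp: adjacency_node_pairs bern_log_lik_def)

text \<open>
  For a fixed candidate \<open>(z, Q)\<close>, a likelihood close to that of the truth is exponentially unlikely
  in the squared distance of the two connection matrices, divided by \<open>R\<close>.
\<close>

lemma likelihood_ratio_tail:
  fixes Q Qs :: "real ^ 'k ^ 'k"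
  assumes Q: "\<And>a b. 0 < Q $ a $ b \<and> Q $ a $ b < 1"
    and Qs: "\<And>a b. 0 < Qs $ a $ b \<and> Qs $ a $ b < 1 \<and> Qs $ a $ b \<le> R"
  shows "measure_pmf.prob (edges n zs Qs)
     {e. t \<le> (log_lik n (adjacency e) z Q - log_lik n (adjacency e) zs Qs) / 2
            + sq_norm n (\<lambda>i j. min R (Q $ z i $ z j) - Qs $ zs i $ zs j) / (8 * R)} \<le> exp (- t)"
proof -
  define f where "f = (\<lambda>(i, j) x. (bern_log_lik (Q $ z i $ z j) x - bern_log_lik (Qs $ zs i $ zs j) x) / 2
      + (min R (Q $ z i $ z j) - Qs $ zs i $ zs j)\<^sup>2 / (8 * R))"
  have "(log_lik n (adjacency e) z Q - log_lik n (adjacency e) zs Qs) / 2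
            + sq_norm n (\<lambda>i j. min R (Q $ z i $ z j) - Qs $ zs i $ zs j) / (8 * R)
      = (\<Sum>x\<in>node_pairs n. f x (e x))" for e
    unfolding log_lik_adjacency sq_norm_def f_def
    by (simp add: sum_subtractf[symmetric] sum_divide_distrib sum.distrib[symmetric] case_prod_unfold diff_divide_distrib)
  moreover have "measure_pmf.prob (edges n zs Qs) {e. t \<le> (\<Sum>x\<in>node_pairs n. f x (e x))} \<le> exp (- t)"
    unfolding edges_def
  proof (rule Pi_pmf_exp_Markov)
    fix x assume "x \<in> node_pairs n"
    show "measure_pmf.expectation (case x of (i, j) \<Rightarrow> bernoulli_pmf (Qs $ zs i $ zs j)) (\<lambda>y. exp (f x y)) \<le> 1"
      using Q Qs by (cases x) (simp add: f_def bern_half_likelihood_ratio del: integral_bernoulli_pmf)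
  qed auto
  ultimately show ?thesis by simp
qed

text \<open>
  The values \<open>1/(N+1), \<dots>, N/(N+1)\<close>. With this shift, rounding \<open>q\<close> to the grid costs a factor of at
  most \<open>1 + 1/N\<close> in \<open>q\<close> and in \<open>1 - q\<close> simultaneously, even near the end points of the interval.
\<close>

definition prob_grid :: "nat \<Rightarrow> real set" where
  "prob_grid N = (\<lambda>m. (real m + 1) / (real N + 1)) ` {..<N}"

lemma prob_grid_in: "q \<in> prob_grid N \<Longrightarrow> 0 < q \<and> q < 1"
  by (auto simp: prob_grid_def field_simps)

lemma prob_grid_approx:
  assumes "0 < q" "q < 1" "0 < N"
  obtains q' where "q' \<in> prob_grid N" "ln q \<le> ln q' + 1 / real N"
    "ln (1 - q) \<le> ln (1 - q') + 1 / real N" "\<bar>q - q'\<bar> \<le> 1 / real N"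
proof -
  define m where "m = nat \<lfloor>q * real N\<rfloor>"
  have m: "real m \<le> q * real N" "q * real N < real m + 1"
    using assms by (auto simp: m_def of_nat_nat)
  have mN: "m < N"
  proof -
    have "q * real N < real N" using assms by simp
    then show ?thesis using m(1) by linarith
  qed
  define q' where "q' = (real m + 1) / (real N + 1)"
  have q': "0 < q'" "q' < 1" using mN by (auto simp: q'_def field_simps)
  have ln_mult: "ln x \<le> ln y + 1 / real N" if "0 < x" "0 < y" "x \<le> y * (1 + 1 / real N)" for x y
  proof -
    have "ln x \<le> ln (y * (1 + 1 / real N))" using that assms by (subst ln_le_cancel_iff) (auto intro!: mult_pos_pos add_pos_pos)
    also have "\<dots> = ln y + ln (1 + 1 / real N)" using that assms by (subst ln_mult) (auto intro!: add_pos_pos)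
    also have "ln (1 + 1 / real N) \<le> 1 / real N" by (rule ln_add_one_self_le_self) simp
    finally show ?thesis by simp
  qed
  have N1: "1 + 1 / real N = (real N + 1) / real N" using assms by (simp add: field_simps)
  have scaled: "q' * (1 + 1 / real N) = (real m + 1) / real N"
    "(1 - q') * (1 + 1 / real N) = (real N - real m) / real N"
    unfolding N1 q'_def by (simp_all add: diff_divide_eq_iff)
  show ?thesis
  proof (rule that)
    show "q' \<in> prob_grid N" using mN by (auto simp: q'_def prob_grid_def)
    show "ln q \<le> ln q' + 1 / real N"
      using m(2) assms q' by (intro ln_mult) (auto simp: scaled pos_le_divide_eq)
    show "ln (1 - q) \<le> ln (1 - q') + 1 / real N"
    proof (rule ln_mult)
      show "1 - q \<le> (1 - q') * (1 + 1 / real N)"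
        unfolding scaled using m(1) assms by (simp add: diff_divide_distrib pos_divide_le_eq)
    qed (use assms q' in auto)
    have "q * real N \<le> q' * (real N + 1)" "q' * (real N + 1) \<le> q * real N + 1"
      using m by (auto simp: q'_def)
    then have "\<bar>q - q'\<bar> * real N \<le> 1"
      using assms q' by (cases "q \<le> q'") (auto simp: algebra_simps)
    then show "\<bar>q - q'\<bar> \<le> 1 / real N" using assms by (simp add: field_simps)
  qed
qed

text \<open>
  The number of parameters in \<open>Q\<close> does not grow with the number of nodes, so the grid contributes
  only a power of \<open>n\<close> to the union bound.
\<close>

lemma card_prob_grid_matrices:
  "finite {Q :: real ^ 'k ^ 'k. \<forall>a b. Q $ a $ b \<in> prob_grid N}"
  "card {Q :: real ^ 'k ^ 'k. \<forall>a b. Q $ a $ b \<in> prob_grid N} \<le> N ^ (CARD('k)\<^sup>2)"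
proof -
  let ?F = "(UNIV :: ('k \<times> 'k) set) \<rightarrow>\<^sub>E prob_grid N"
  let ?M = "{Q :: real ^ 'k ^ 'k. \<forall>a b. Q $ a $ b \<in> prob_grid N}"
  have fin: "finite ?F" by (intro finite_PiE) (auto simp: prob_grid_def)
  have sub: "?M \<subseteq> (\<lambda>\<phi>. \<chi> a b. \<phi> (a, b)) ` ?F"
  proof
    fix Q assume "Q \<in> ?M"
    then have "(\<lambda>(a, b). Q $ a $ b) \<in> ?F" "Q = (\<chi> a b. (\<lambda>(a, b). Q $ a $ b) (a, b))"
      by (auto simp: vec_eq_iff)
    then show "Q \<in> (\<lambda>\<phi>. \<chi> a b. \<phi> (a, b)) ` ?F" by blast
  qed
  show "finite ?M" using sub fin by (meson finite_imageI finite_subset)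
  have "card ?M \<le> card ?F" by (rule surj_card_le[OF fin sub])
  also have "\<dots> = card (prob_grid N) ^ CARD('k \<times> 'k)" by (simp add: card_PiE)
  also have "\<dots> \<le> N ^ CARD('k \<times> 'k)"
    by (intro power_mono) (auto simp: prob_grid_def intro: order_trans[OF card_image_le])
  finally show "card ?M \<le> N ^ (CARD('k)\<^sup>2)" by (simp add: power2_eq_square)
qed

lemma card_labelings: "card (labelings n :: (nat \<Rightarrow> 'k::finite) set) = CARD('k) ^ n"
  by (simp add: labelings_def card_PiE)

text \<open>
  A union bound over all labelings and over the grid with \<open>N = n\<^sup>2\<close>. Rounding then changes the
  log-likelihood by at most 1, and the squared distance by a factor of at most 2 and a summand of at most
  \<open>2 R\<close>. The additional 1 in the threshold and the factor \<open>1 / (16 R)\<close> in place of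
  \<open>1 / (8 R)\<close> absorb this.
\<close>

lemma likelihood_ratio_tail_uniform:
  fixes Qs :: "real ^ 'k ^ 'k"
  assumes Qs: "\<And>a b. 0 < Qs $ a $ b \<and> Qs $ a $ b < 1 \<and> Qs $ a $ b \<le> R"
    and n: "0 < n" "1 \<le> real n * R"
  shows "measure_pmf.prob (edges n zs Qs)
     {e. \<exists>z\<in>labelings n. \<exists>Q :: real ^ 'k ^ 'k. (\<forall>a b. 0 < Q $ a $ b \<and> Q $ a $ b < 1) \<and>
        t + 1 \<le> (log_lik n (adjacency e) z Q - log_lik n (adjacency e) zs Qs) / 2
            + sq_norm n (\<lambda>i j. min R (Q $ z i $ z j) - Qs $ zs i $ zs j) / (16 * R)}
    \<le> real CARD('k) ^ n * real n ^ (2 * CARD('k)\<^sup>2) * exp (- t)" (is "measure_pmf.prob _ ?B \<le> _")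
proof -
  define N where "N = n\<^sup>2"
  have N: "0 < N" using n by (simp add: N_def)
  have R: "0 < R" using Qs[of undefined undefined] by linarith
  let ?G = "{Q :: real ^ 'k ^ 'k. \<forall>a b. Q $ a $ b \<in> prob_grid N}"
  let ?L = "\<lambda>e z Q. (log_lik n (adjacency e) z Q - log_lik n (adjacency e) zs Qs) / 2"
  let ?D = "\<lambda>z Q. sq_norm n (\<lambda>i j. min R (Q $ z i $ z j) - Qs $ zs i $ zs j)"
  have round: "\<exists>Q'\<in>?G. t \<le> ?L e z Q' + ?D z Q' / (8 * R)"
    if Q: "\<forall>a b. 0 < Q $ a $ b \<and> Q $ a $ b < 1" and t: "t + 1 \<le> ?L e z Q + ?D z Q / (16 * R)"
    for e z and Q :: "real ^ 'k ^ 'k"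
  proof -
    have "\<exists>q'. q' \<in> prob_grid N \<and> ln (Q $ a $ b) \<le> ln q' + 1 / real N \<and>
       ln (1 - Q $ a $ b) \<le> ln (1 - q') + 1 / real N \<and> \<bar>Q $ a $ b - q'\<bar> \<le> 1 / real N" for a b
      using prob_grid_approx[of "Q $ a $ b" N] Q N by blast
    then obtain g where g: "\<And>a b. g a b \<in> prob_grid N"
       "\<And>a b. ln (Q $ a $ b) \<le> ln (g a b) + 1 / real N"
       "\<And>a b. ln (1 - Q $ a $ b) \<le> ln (1 - g a b) + 1 / real N"
       "\<And>a b. \<bar>Q $ a $ b - g a b\<bar> \<le> 1 / real N"
      by metis
    define Q' :: "real ^ 'k ^ 'k" where "Q' = (\<chi> a b. g a b)"
    have card: "real (card (node_pairs n)) \<le> real N"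
      using card_node_pairs_le[of n] unfolding N_def by (rule of_nat_mono)
    have "log_lik n (adjacency e) z Q \<le> (\<Sum>(i, j)\<in>node_pairs n. bern_log_lik (Q' $ z i $ z j) (e (i, j)) + 1 / real N)"
      unfolding log_lik_adjacency
      by (rule sum_mono) (auto simp: Q'_def bern_log_lik_def g)
    also have "\<dots> = log_lik n (adjacency e) z Q' + real (card (node_pairs n)) / real N"
      by (simp add: log_lik_adjacency case_prod_unfold sum.distrib)
    also have "\<dots> \<le> log_lik n (adjacency e) z Q' + 1"
      using card N by simp
    finally have L: "?L e z Q \<le> ?L e z Q' + 1 / 2" by (simp add: field_simps)
    have "?D z Q \<le> (\<Sum>(i, j)\<in>node_pairs n. 2 * (min R (Q' $ z i $ z j) - Qs $ zs i $ zs j)\<^sup>2 + 2 * (1 / real N)\<^sup>2)"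
      unfolding sq_norm_def
    proof (rule sum_mono, safe)
      fix i j
      define x y where "x = min R (Q' $ z i $ z j) - Qs $ zs i $ zs j"
        and "y = min R (Q $ z i $ z j) - min R (Q' $ z i $ z j)"
      have "\<bar>y\<bar> \<le> 1 / real N"
        using g(4)[of "z i" "z j"] by (auto simp: y_def Q'_def min_def abs_if split: if_splits)
      then have "y\<^sup>2 \<le> (1 / real N)\<^sup>2" by (metis abs_le_square_iff abs_of_nonneg of_nat_0_le_iff zero_le_divide_1_iff)
      moreover have "(x + y)\<^sup>2 \<le> 2 * x\<^sup>2 + 2 * y\<^sup>2"
        using sum_squares_bound[of x y] by (simp add: power2_sum)
      ultimately have "(x + y)\<^sup>2 \<le> 2 * x\<^sup>2 + 2 * (1 / real N)\<^sup>2" by linarith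
      moreover have "min R (Q $ z i $ z j) - Qs $ zs i $ zs j = x + y" by (simp add: x_def y_def)
      ultimately show "(min R (Q $ z i $ z j) - Qs $ zs i $ zs j)\<^sup>2 \<le>
          2 * (min R (Q' $ z i $ z j) - Qs $ zs i $ zs j)\<^sup>2 + 2 * (1 / real N)\<^sup>2"
        by (simp only: x_def)
    qed
    also have "\<dots> = 2 * ?D z Q' + 2 * (real (card (node_pairs n)) * (1 / real N)\<^sup>2)"
      by (simp add: sq_norm_def case_prod_unfold sum.distrib sum_distrib_left)
    also have "\<dots> \<le> 2 * ?D z Q' + 2 * (real N * (1 / real N)\<^sup>2)"
      using card by (intro add_left_mono mult_left_mono mult_right_mono) auto
    also have "real N * (1 / real N)\<^sup>2 = 1 / real N" using N by (simp add: power2_eq_square)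
    also have "1 / real N \<le> R"
    proof -
      have "1 \<le> real n * R" by (rule n(2))
      also have "\<dots> \<le> real N * R"
        using n(1) R unfolding N_def by (intro mult_right_mono of_nat_mono) (auto simp: power2_eq_square)
      finally show ?thesis using N by (simp add: field_simps)
    qed
    finally have "?D z Q / (16 * R) \<le> ?D z Q' / (8 * R) + 1 / 8"
      using R by (simp add: field_simps)
    then have "t \<le> ?L e z Q' + ?D z Q' / (8 * R)" using L t by linarith
    moreover have "Q' \<in> ?G" using g(1) by (simp add: Q'_def)
    ultimately show ?thesis by blast
  qed
  have "measure_pmf.prob (edges n zs Qs) ?B \<le>
     measure_pmf.prob (edges n zs Qs) {e. \<exists>y\<in>labelings n \<times> ?G. t \<le> ?L e (fst y) (snd y) + ?D (fst y) (snd y) / (8 * R)}"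
  proof (rule measure_pmf.finite_measure_mono)
    show "?B \<subseteq> {e. \<exists>y\<in>labelings n \<times> ?G. t \<le> ?L e (fst y) (snd y) + ?D (fst y) (snd y) / (8 * R)}"
    proof
      fix e assume "e \<in> ?B"
      then obtain z and Q :: "real ^ 'k ^ 'k" where "z \<in> labelings n" "\<forall>a b. 0 < Q $ a $ b \<and> Q $ a $ b < 1"
        "t + 1 \<le> ?L e z Q + ?D z Q / (16 * R)" by blast
      with round obtain Q' where "Q' \<in> ?G" "t \<le> ?L e z Q' + ?D z Q' / (8 * R)" by blast
      with \<open>z \<in> labelings n\<close> show "e \<in> {e. \<exists>y\<in>labelings n \<times> ?G. t \<le> ?L e (fst y) (snd y) + ?D (fst y) (snd y) / (8 * R)}"
        by force
    qed
  qed simp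
  also have "\<dots> \<le> real (card ((labelings n :: (nat \<Rightarrow> 'k) set) \<times> ?G)) * exp (- t)"
  proof (rule prob_Ex_le_card)
    show "finite ((labelings n :: (nat \<Rightarrow> 'k) set) \<times> ?G)"
      by (intro finite_cartesian_product finite_labelings card_prob_grid_matrices)
    fix y :: "(nat \<Rightarrow> 'k) \<times> (real ^ 'k ^ 'k)" assume "y \<in> labelings n \<times> ?G"
    then have "snd y $ a $ b \<in> prob_grid N" for a b by auto
    from likelihood_ratio_tail[OF prob_grid_in[OF this] Qs]
    show "measure_pmf.prob (edges n zs Qs) {e. t \<le> ?L e (fst y) (snd y) + ?D (fst y) (snd y) / (8 * R)} \<le> exp (- t)"
      by simp
  qed
  also have "\<dots> \<le> (real CARD('k) ^ n * real n ^ (2 * CARD('k)\<^sup>2)) * exp (- t)"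
  proof (rule mult_right_mono)
    have "card ((labelings n :: (nat \<Rightarrow> 'k) set) \<times> ?G) \<le> CARD('k) ^ n * N ^ (CARD('k)\<^sup>2)"
      unfolding card_cartesian_product card_labelings
      by (intro mult_left_mono card_prob_grid_matrices) auto
    also have "N ^ (CARD('k)\<^sup>2) = n ^ (2 * CARD('k)\<^sup>2)" by (simp add: N_def power_mult)
    finally have "real (card ((labelings n :: (nat \<Rightarrow> 'k) set) \<times> ?G)) \<le> real (CARD('k) ^ n * n ^ (2 * CARD('k)\<^sup>2))"
      by (rule of_nat_mono)
    then show "real (card ((labelings n :: (nat \<Rightarrow> 'k) set) \<times> ?G)) \<le> real CARD('k) ^ n * real n ^ (2 * CARD('k)\<^sup>2)"
      by simp
  qed simp
  finally show ?thesis .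
qed

section \<open>Block averages\<close>

text \<open>
  Unordered pairs, each represented once by its increasing enumeration. In this form the diagonal
  blocks and the off-diagonal ones can be treated alike.
\<close>

definition pair_block :: "nat \<Rightarrow> (nat \<Rightarrow> 'k) \<Rightarrow> 'k \<Rightarrow> 'k \<Rightarrow> (nat \<times> nat) set" where
  "pair_block n z a b = {(i, j) \<in> node_pairs n. (z i = a \<and> z j = b) \<or> (z i = b \<and> z j = a)}"

lemma pair_block_subset: "pair_block n z a b \<subseteq> node_pairs n"
  by (auto simp: pair_block_def)

lemma finite_pair_block [simp]: "finite (pair_block n z a b)"
  by (rule finite_subset[OF pair_block_subset]) simp

lemma finite_block [simp]: "finite (block n z a)"
  by (simp add: block_def)

text \<open>
  The factor 2 for \<open>a = b\<close> is the same in the numerator of the block mean and in \<^const>\<open>block_count\<close>,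
  where \<open>m (m - 1)\<close> stands for the number \<open>m (m - 1) / 2\<close> of pairs in a class of size \<open>m\<close>, so
  it cancels.
\<close>

lemma sum_block_block:
  fixes f :: "nat \<Rightarrow> nat \<Rightarrow> real"
  assumes sym: "\<And>i j. f i j = f j i" and diag: "\<And>i. f i i = 0"
  shows "(\<Sum>i\<in>block n z a. \<Sum>j\<in>block n z b. f i j) =
    (if a = b then 2 else 1) * (\<Sum>(i, j)\<in>pair_block n z a b. f i j)"
proof -
  define D where "D = (\<lambda>a b. {(i, j) \<in> node_pairs n. z i = a \<and> z j = b})"
  have finD: "finite (D a b)" for a b
    by (rule finite_subset[of _ "node_pairs n"]) (auto simp: D_def)
  have "(\<Sum>i\<in>block n z a. \<Sum>j\<in>block n z b. f i j) = (\<Sum>(i, j)\<in>block n z a \<times> block n z b. f i j)"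
    by (simp add: sum.cartesian_product)
  also have "\<dots> = (\<Sum>(i, j)\<in>D a b \<union> prod.swap ` D b a. f i j)"
  proof (rule sum.mono_neutral_right)
    show "D a b \<union> prod.swap ` D b a \<subseteq> block n z a \<times> block n z b"
      by (auto simp: D_def block_def node_pairs_def)
    show "\<forall>x\<in>block n z a \<times> block n z b - (D a b \<union> prod.swap ` D b a). (case x of (i, j) \<Rightarrow> f i j) = 0"
    proof
      fix x assume x: "x \<in> block n z a \<times> block n z b - (D a b \<union> prod.swap ` D b a)"
      obtain i j where [simp]: "x = (i, j)" by (cases x)
      have "\<not> i < j" using x by (auto simp: D_def block_def node_pairs_def)
      moreover have "\<not> j < i"
      proof
        assume "j < i"
        then have "(j, i) \<in> D b a" using x by (auto simp: D_def block_def node_pairs_def)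
        then have "x \<in> prod.swap ` D b a" by force
        then show False using x by simp
      qed
      ultimately show "(case x of (i, j) \<Rightarrow> f i j) = 0" using diag by simp
    qed
  qed simp
  also have "\<dots> = (\<Sum>(i, j)\<in>D a b. f i j) + (\<Sum>(i, j)\<in>prod.swap ` D b a. f i j)"
  proof (rule sum.union_disjoint)
    have "D a b \<subseteq> {(i, j). i < j}" "prod.swap ` D b a \<subseteq> {(i, j). j < i}"
      by (auto simp: D_def node_pairs_def)
    then have "D a b \<inter> prod.swap ` D b a \<subseteq> {(i, j). i < j} \<inter> {(i, j). j < i}" by blast
    also have "{(i, j). i < j} \<inter> {(i, j). j < i} = ({} :: (nat \<times> nat) set)" by auto
    finally show "D a b \<inter> prod.swap ` D b a = {}" by simp
  qed (use finD in auto)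
  also have "(\<Sum>(i, j)\<in>prod.swap ` D b a. f i j) = (\<Sum>(i, j)\<in>D b a. f i j)"
    by (subst sum.reindex) (auto simp: sym case_prod_unfold)
  finally have eq: "(\<Sum>i\<in>block n z a. \<Sum>j\<in>block n z b. f i j) =
     (\<Sum>(i, j)\<in>D a b. f i j) + (\<Sum>(i, j)\<in>D b a. f i j)" .
  show ?thesis
  proof (cases "a = b")
    case True
    then have "pair_block n z a b = D a b" by (auto simp: pair_block_def D_def)
    then show ?thesis using eq True by simp
  next
    case False
    have "pair_block n z a b = D a b \<union> D b a" by (auto simp: pair_block_def D_def)
    moreover have "(\<Sum>(i, j)\<in>D a b \<union> D b a. f i j) = (\<Sum>(i, j)\<in>D a b. f i j) + (\<Sum>(i, j)\<in>D b a. f i j)"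
    proof (rule sum.union_disjoint)
      show "D a b \<inter> D b a = {}" using False by (auto simp: D_def)
    qed (use finD in auto)
    ultimately show ?thesis using eq False by simp
  qed
qed

lemma sum_off_diagonal:
  fixes f :: "nat \<Rightarrow> nat \<Rightarrow> real"
  assumes "\<And>i j. f i j = f j i" "\<And>i. f i i = 0"
  shows "(\<Sum>i<n. \<Sum>j<n. f i j) = 2 * (\<Sum>(i, j)\<in>node_pairs n. f i j)"
proof -
  have eq: "(\<Sum>i\<in>block n (\<lambda>_. True) True. \<Sum>j\<in>block n (\<lambda>_. True) True. f i j) =
      (if True = True then 2 else 1) * (\<Sum>(i, j)\<in>pair_block n (\<lambda>_. True) True True. f i j)"
    by (rule sum_block_block) (fact assms)+
  have one: "block n (\<lambda>_. True) True = {..<n}" "pair_block n (\<lambda>_. True) True True = node_pairs n"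
    by (auto simp: block_def pair_block_def)
  show ?thesis using eq unfolding one by (simp only: refl if_True)
qed

lemma block_count_pair_block:
  "block_count n z a b = (if a = b then 2 else 1) * real (card (pair_block n z a b))"
proof -
  let ?f = "\<lambda>i j :: nat. of_bool (i \<noteq> j) :: real"
  have "(\<Sum>i\<in>block n z a. \<Sum>j\<in>block n z b. ?f i j) =
      (if a = b then 2 else 1) * (\<Sum>(i, j)\<in>pair_block n z a b. ?f i j)"
    by (rule sum_block_block) auto
  also have "(\<Sum>(i, j)\<in>pair_block n z a b. ?f i j) = (\<Sum>x\<in>pair_block n z a b. 1)"
    by (rule sum.cong) (auto simp: pair_block_def node_pairs_def)
  finally have eq: "(\<Sum>i\<in>block n z a. \<Sum>j\<in>block n z b. ?f i j) =
     (if a = b then 2 else 1) * real (card (pair_block n z a b))" by simp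
  show ?thesis
  proof (cases "a = b")
    case True
    have "(\<Sum>j\<in>block n z a. ?f i j) = real (card (block n z a)) - 1" if "i \<in> block n z a" for i
    proof -
      have "(\<Sum>j\<in>block n z a. ?f i j) = (\<Sum>j\<in>block n z a. 1 - (if i = j then 1 else 0))"
        by (rule sum.cong) auto
      also have "\<dots> = real (card (block n z a)) - 1"
        using that by (simp only: sum_subtractf) simp
      finally show ?thesis .
    qed
    then show ?thesis using eq True by (simp add: block_count_def)
  next
    case False
    have "(\<Sum>i\<in>block n z a. \<Sum>j\<in>block n z b. ?f i j) = (\<Sum>i\<in>block n z a. \<Sum>j\<in>block n z b. 1)"
      using False by (intro sum.cong) (auto simp: block_def)
    then show ?thesis using eq False by (simp add: block_count_def)
  qed
qed

lemma block_means_eq_average: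
  assumes "\<And>i j. A i j = A j i" "\<And>i. A i i = 0"
  shows "block_means n A z $ a $ b =
    (\<Sum>(i, j)\<in>pair_block n z a b. A i j) / real (card (pair_block n z a b))"
proof -
  let ?c = "if a = b then 2 else 1 :: real"
  have eq: "(\<Sum>i\<in>block n z a. \<Sum>j\<in>block n z b. A i j) =
      ?c * (\<Sum>(i, j)\<in>pair_block n z a b. A i j)"
    by (rule sum_block_block) (fact assms)+
  have "block_means n A z $ a $ b = (\<Sum>i\<in>block n z a. \<Sum>j\<in>block n z b. A i j) / block_count n z a b"
    by (simp add: block_means_def)
  also have "\<dots> = (\<Sum>(i, j)\<in>pair_block n z a b. A i j) / real (card (pair_block n z a b))"
    unfolding eq block_count_pair_block by (rule mult_divide_mult_cancel_left) simp
  finally show ?thesis .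
qed

text \<open>
  Averaging is an orthogonal projection: the average of the observations \<open>A\<close> splits the error into the
  deviation of \<open>\<theta>\<close> from its own average, which is at most the one from any constant \<open>q\<close>,
  and the averaged noise.
\<close>

lemma sum_sq_dev_average_le:
  fixes \<theta> A :: "'i \<Rightarrow> real"
  assumes "finite P"
  shows "(\<Sum>x\<in>P. (\<theta> x - (\<Sum>x\<in>P. A x) / real (card P))\<^sup>2) \<le>
     (\<Sum>x\<in>P. (\<theta> x - q)\<^sup>2) + (\<Sum>x\<in>P. A x - \<theta> x)\<^sup>2 / real (card P)"
proof (cases "P = {}")
  case False
  define N S W where "N = real (card P)" and "S = sum \<theta> P" and "W = (\<Sum>x\<in>P. A x - \<theta> x)"
  have N: "0 < N" using False assms by (simp add: N_def card_gt_0_iff)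
  have expand: "(\<Sum>x\<in>P. (\<theta> x - c)\<^sup>2) = (\<Sum>x\<in>P. (\<theta> x)\<^sup>2) - 2 * c * S + N * c\<^sup>2" for c
  proof -
    have "(\<Sum>x\<in>P. (\<theta> x - c)\<^sup>2) = (\<Sum>x\<in>P. (\<theta> x)\<^sup>2 - (2 * c) * \<theta> x + c\<^sup>2)"
      by (simp add: power2_diff algebra_simps)
    also have "\<dots> = (\<Sum>x\<in>P. (\<theta> x)\<^sup>2) - 2 * c * S + N * c\<^sup>2"
      by (simp only: sum.distrib sum_subtractf sum_distrib_left[symmetric] S_def N_def sum_constant)
    finally show ?thesis .
  qed
  have "sum A P = S + W" by (simp add: S_def W_def sum_subtractf)
  then have "(\<Sum>x\<in>P. (\<theta> x - q)\<^sup>2) + W\<^sup>2 / N - (\<Sum>x\<in>P. (\<theta> x - sum A P / N)\<^sup>2) = (S - N * q)\<^sup>2 / N"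
    unfolding expand using N by (simp add: field_simps power2_eq_square)
  also have "\<dots> \<ge> 0" using N by simp
  finally show ?thesis by (simp add: N_def W_def)
qed simp

section \<open>Classes of a well-fitting labeling are large\<close>

text \<open>
  On \<open>X \<times> Y\<close> without the diagonal, \<open>M\<close> equals \<open>v\<close>; the diagonal takes away at most half of the
  rectangle, and each unordered pair is met at most twice. Together this gives the factor 4.
\<close>

lemma sq_norm_ge_rectangle:
  fixes M :: "nat \<Rightarrow> nat \<Rightarrow> real"
  assumes sym: "\<And>i j. M i j = M j i"
    and XY: "X \<subseteq> {..<n}" "Y \<subseteq> {..<n}" "m \<le> real (card X)" "m \<le> real (card Y)" "2 \<le> m"
    and v: "\<And>i j. i \<in> X \<Longrightarrow> j \<in> Y \<Longrightarrow> M i j = v"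
  shows "v\<^sup>2 * m\<^sup>2 \<le> 4 * sq_norm n M"
proof -
  define f where "f = (\<lambda>i j. if i = j then 0 else (M i j)\<^sup>2)"
  have fin: "finite X" "finite Y" using XY finite_subset by blast+
  have inner: "v\<^sup>2 * (m / 2) \<le> (\<Sum>j\<in>Y. f i j)" if "i \<in> X" for i
  proof -
    have "v\<^sup>2 * (m / 2) \<le> v\<^sup>2 * real (card (Y - {i}))"
    proof (rule mult_left_mono)
      have "card Y - 1 \<le> card (Y - {i})" using diff_card_le_card_Diff[of "{i}" Y] by simp
      then show "m / 2 \<le> real (card (Y - {i}))" using XY by linarith
    qed simp
    also have "\<dots> = (\<Sum>j\<in>Y - {i}. f i j)"
      using v that by (simp add: f_def)
    also have "\<dots> \<le> (\<Sum>j\<in>Y. f i j)"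
      using fin by (intro sum_mono2) (auto simp: f_def)
    finally show ?thesis .
  qed
  have "v\<^sup>2 * m\<^sup>2 = 2 * (m * (v\<^sup>2 * (m / 2)))" by (simp add: power2_eq_square)
  also have "\<dots> \<le> 2 * (real (card X) * (v\<^sup>2 * (m / 2)))"
    using XY by (intro mult_left_mono mult_right_mono) auto
  also have "\<dots> \<le> 2 * (\<Sum>i\<in>X. \<Sum>j\<in>Y. f i j)"
  proof -
    have "(\<Sum>i\<in>X. v\<^sup>2 * (m / 2)) \<le> (\<Sum>i\<in>X. \<Sum>j\<in>Y. f i j)" by (rule sum_mono) (rule inner)
    then show ?thesis by simp
  qed
  also have "(\<Sum>i\<in>X. \<Sum>j\<in>Y. f i j) \<le> (\<Sum>i\<in>X. \<Sum>j<n. f i j)"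
    using XY by (intro sum_mono sum_mono2) (auto simp: f_def)
  also have "\<dots> \<le> (\<Sum>i<n. \<Sum>j<n. f i j)"
    using XY by (intro sum_mono2) (auto simp: f_def intro!: sum_nonneg)
  also have "\<dots> = 2 * (\<Sum>(i, j)\<in>node_pairs n. f i j)"
    by (rule sum_off_diagonal) (auto simp: f_def sym)
  also have "(\<Sum>(i, j)\<in>node_pairs n. f i j) = sq_norm n M"
    unfolding sq_norm_def by (rule sum.cong) (auto simp: f_def node_pairs_def)
  finally show ?thesis by simp
qed

lemma transpose_eq_self_entry:
  assumes "transpose Q = Q" shows "Q $ a $ b = Q $ b $ a"
proof -
  have "transpose Q $ a $ b = Q $ b $ a" by (simp add: transpose_def)
  then show ?thesis using assms by simp
qed

text \<open>
  If the estimated class \<open>c\<close> is small, each true class has a large intersection with one of the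
  remaining estimated classes, and by the pigeonhole principle two true classes \<open>a\<close>, \<open>b\<close> share it.
  Their columns differ in some row \<open>d\<close>. On two large rectangles the same entry of \<open>Q\<close> then has to
  approximate both \<open>Qs $ d $ a\<close> and \<open>Qs $ d $ b\<close>, which contradicts the closeness.
\<close>

lemma blocks_large_if_close:
  fixes Q Qs :: "real ^ 'k ^ 'k"
  assumes sym: "transpose Q = Q" "transpose Qs = Qs"
    and gap: "\<And>a b. a \<noteq> b \<Longrightarrow> \<exists>d. g \<le> \<bar>Qs $ d $ a - Qs $ d $ b\<bar>"
    and classes: "\<And>a. real CARD('k) * m \<le> real (card (block n zs a))"
    and m: "2 \<le> m" and g: "0 < g"
    and close: "16 * sq_norm n (\<lambda>i j. Q $ z i $ z j - Qs $ zs i $ zs j) < g\<^sup>2 * m\<^sup>2"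
  shows "m \<le> real (card (block n z c))"
proof (rule ccontr)
  let ?M = "\<lambda>i j. Q $ z i $ z j - Qs $ zs i $ zs j"
  have symQ: "Q $ a $ b = Q $ b $ a" "Qs $ a $ b = Qs $ b $ a" for a b
    using sym by (blast intro: transpose_eq_self_entry)+
  assume small: "\<not> m \<le> real (card (block n z c))"
  have "\<exists>b. b \<noteq> c \<and> m \<le> real (card (block n zs a \<inter> block n z b))" for a
  proof (rule ccontr)
    assume neg: "\<nexists>b. b \<noteq> c \<and> m \<le> real (card (block n zs a \<inter> block n z b))"
    have less: "real (card (block n zs a \<inter> block n z b)) < m" for b
    proof (cases "b = c")
      case True
      have "card (block n zs a \<inter> block n z b) \<le> card (block n z c)"
        using True by (intro card_mono) auto
      then show ?thesis using small by linarith
    qed (use neg in force)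
    have "block n zs a = (\<Union>b. block n zs a \<inter> block n z b)" by (auto simp: block_def)
    then have "card (block n zs a) \<le> (\<Sum>b\<in>UNIV. card (block n zs a \<inter> block n z b))"
      by (metis card_UN_le finite_code)
    then have "real (card (block n zs a)) \<le> (\<Sum>b\<in>UNIV. real (card (block n zs a \<inter> block n z b)))"
      by (metis of_nat_mono of_nat_sum)
    also have "\<dots> < (\<Sum>b\<in>(UNIV :: 'k set). m)" by (rule sum_strict_mono) (use less in auto)
    finally show False using classes[of a] by simp
  qed
  then obtain h where h: "\<And>a. h a \<noteq> c" "\<And>a. m \<le> real (card (block n zs a \<inter> block n z (h a)))"
    by metis
  have "\<not> inj h"
  proof
    assume "inj h"
    then have "surj h" by (simp add: finite_UNIV_inj_surj)
    then show False using h(1) by (metis surj_def)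
  qed
  then obtain a b where ab: "a \<noteq> b" "h a = h b" by (auto simp: inj_on_def)
  obtain d where d: "g \<le> \<bar>Qs $ d $ a - Qs $ d $ b\<bar>" using gap[OF ab(1)] by blast
  have rect: "(Q $ h d $ h x - Qs $ d $ x)\<^sup>2 * m\<^sup>2 \<le> 4 * sq_norm n ?M" for x
    by (rule sq_norm_ge_rectangle[where X = "block n zs d \<inter> block n z (h d)" and Y = "block n zs x \<inter> block n z (h x)"])
      (use h m in \<open>auto simp: block_def symQ\<close>)
  define u v where "u = Q $ h d $ h a - Qs $ d $ a" and "v = Q $ h d $ h a - Qs $ d $ b"
  have "\<bar>g\<bar> \<le> \<bar>u - v\<bar>" using d g unfolding u_def v_def by linarith
  then have "g\<^sup>2 \<le> (u - v)\<^sup>2" by (simp only: abs_le_square_iff)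
  also have "\<dots> \<le> 2 * u\<^sup>2 + 2 * v\<^sup>2"
    using sum_squares_bound[of u "-v"] by (simp add: power2_diff)
  finally have "g\<^sup>2 * m\<^sup>2 \<le> (2 * u\<^sup>2 + 2 * v\<^sup>2) * m\<^sup>2" by (rule mult_right_mono) simp
  also have "\<dots> = 2 * (u\<^sup>2 * m\<^sup>2) + 2 * (v\<^sup>2 * m\<^sup>2)" by (simp add: algebra_simps)
  also have "\<dots> \<le> 16 * sq_norm n ?M"
    using rect[of a] rect[of b] ab(2) by (simp add: u_def v_def)
  finally show False using close by simp
qed

lemma card_pair_block_ge:
  assumes "\<And>c. m \<le> real (card (block n z c))" "2 \<le> m"
  shows "m\<^sup>2 / 4 \<le> real (card (pair_block n z a b))"
proof (cases "a = b")
  case True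
  have "m * (m / 2) \<le> real (card (block n z a)) * (real (card (block n z a)) - 1)"
    using assms(1)[of a] assms(2) by (intro mult_mono) auto
  then show ?thesis using block_count_pair_block[of n z a b] True
    by (simp add: block_count_def power2_eq_square)
next
  case False
  have "m * m \<le> real (card (block n z a)) * real (card (block n z b))"
    using assms(1)[of a] assms(1)[of b] assms(2) by (intro mult_mono) auto
  then have "m\<^sup>2 \<le> real (card (pair_block n z a b))" using block_count_pair_block[of n z a b] False
    by (simp add: block_count_def power2_eq_square)
  moreover have "0 \<le> m\<^sup>2" by simp
  ultimately show ?thesis by linarith
qed

section \<open>The variational estimator\<close>

lemma sum_pmf_product_labels:
  "(\<Sum>z\<in>labelings n. pmf (product_labels n (\<tau> :: nat \<Rightarrow> real ^ 'k::finite)) z) = 1"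
  by (rule sum_pmf_eq_1[OF finite_labelings set_product_labels_subset])

lemma ln_joint_weight:
  assumes "\<forall>a. 0 < \<alpha> $ a"
  shows "ln (joint_weight n A \<alpha> Q z) = ln (\<Prod>i<n. \<alpha> $ z i) + log_lik n A z Q"
proof -
  have "0 < (\<Prod>i<n. \<alpha> $ z i)" using assms by (simp add: prod_pos)
  then show ?thesis by (simp add: joint_weight_def ln_mult_pos)
qed

text \<open>
  The normalising constant of the posterior cancels; what remains is the evidence lower bound.
\<close>

lemma var_objective_eq:
  fixes \<tau> :: "nat \<Rightarrow> real ^ 'k::finite"
  assumes "\<forall>a. 0 < \<alpha> $ a"
  shows "var_objective n A \<tau> \<alpha> Q =
    (\<Sum>z\<in>labelings n. pmf (product_labels n \<tau>) z *
       (ln (\<Prod>i<n. \<alpha> $ z i) + log_lik n A z Q - ln (pmf (product_labels n \<tau>) z)))"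
proof -
  let ?p = "pmf (product_labels n \<tau>)" and ?m = "marginal_lik n A \<alpha> Q"
  have m: "0 < ?m" by (rule marginal_lik_pos[OF assms])
  have "var_objective n A \<tau> \<alpha> Q = ln ?m * (\<Sum>z\<in>labelings n. ?p z) -
      (\<Sum>z\<in>labelings n. ?p z * ln (?p z / pmf (posterior n A \<alpha> Q) z))"
    by (simp add: var_objective_def KL_product_labels_posterior[OF assms] sum_pmf_product_labels)
  also have "\<dots> = (\<Sum>z\<in>labelings n. ?p z * (ln ?m - ln (?p z / pmf (posterior n A \<alpha> Q) z)))"
    by (simp add: sum_distrib_left sum_subtractf[symmetric] algebra_simps)
  also have "\<dots> = (\<Sum>z\<in>labelings n. ?p z * (ln (\<Prod>i<n. \<alpha> $ z i) + log_lik n A z Q - ln (?p z)))"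
  proof (rule sum.cong[OF refl])
    fix z :: "nat \<Rightarrow> 'k" assume z: "z \<in> labelings n"
    have j: "0 < joint_weight n A \<alpha> Q z" by (rule joint_weight_pos[OF assms])
    show "?p z * (ln ?m - ln (?p z / pmf (posterior n A \<alpha> Q) z)) =
       ?p z * (ln (\<Prod>i<n. \<alpha> $ z i) + log_lik n A z Q - ln (?p z))"
    proof (cases "?p z = 0")
      case False
      then have "0 < ?p z" by (simp add: order_less_le)
      then show ?thesis using z j m
        by (simp add: pmf_posterior[OF assms] ln_div ln_mult_pos ln_joint_weight[OF assms, symmetric])
    qed simp
  qed
  finally show ?thesis .
qed

text \<open>
  The prior term and the entropy add up to minus the divergence of the mean-field law from the prior,
  hence are at most 0 by Gibbs' inequality.
  This bounds the objective by the mean log-likelihood, whatever the estimate of \<open>\<alpha>\<close>.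
\<close>

lemma var_objective_le:
  fixes \<tau> :: "nat \<Rightarrow> real ^ 'k::finite"
  assumes "\<forall>a. 0 < \<alpha> $ a" "prob_vector \<alpha>"
  shows "var_objective n A \<tau> \<alpha> Q \<le>
    (\<Sum>z\<in>labelings n. pmf (product_labels n \<tau>) z * log_lik n A z Q)"
proof -
  let ?p = "pmf (product_labels n \<tau>)"
  let ?\<pi> = "\<lambda>z. \<Prod>i<n. \<alpha> $ z i"
  let ?r = "product_labels n (\<lambda>i\<in>{..<n}. \<alpha>)"
  have pi: "0 < ?\<pi> z" for z using assms(1) by (auto intro!: prod_pos)
  have gibbs: "?p z * (ln (?\<pi> z) - ln (?p z)) \<le> ?\<pi> z - ?p z" for z
  proof (cases "?p z = 0")
    case True
    then show ?thesis using less_imp_le[OF pi[of z]] by simp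
  next
    case False
    then have p: "0 < ?p z" by (simp add: order_less_le)
    have "ln (?\<pi> z) - ln (?p z) = ln (?\<pi> z / ?p z)"
      using p pi[of z] by (intro ln_divide_pos[symmetric])
    also have "\<dots> \<le> ?\<pi> z / ?p z - 1" using p pi[of z] by (intro ln_le_minus_one) auto
    finally have "?p z * (ln (?\<pi> z) - ln (?p z)) \<le> ?p z * (?\<pi> z / ?p z - 1)"
      using p by (intro mult_left_mono) auto
    also have "\<dots> = ?\<pi> z - ?p z" using p by (simp add: algebra_simps)
    finally show ?thesis .
  qed
  have "(\<Sum>z\<in>labelings n. ?\<pi> z) = (\<Sum>z\<in>labelings n. pmf ?r z)"
  proof (rule sum.cong[OF refl])
    fix z :: "nat \<Rightarrow> 'k" assume "z \<in> labelings n"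
    then show "?\<pi> z = pmf ?r z"
      using assms(2) by (subst pmf_product_labels) (auto simp: var_params_def)
  qed
  then have sum\<pi>: "(\<Sum>z\<in>labelings n. ?\<pi> z) = 1" by (simp add: sum_pmf_product_labels)
  have "var_objective n A \<tau> \<alpha> Q =
      (\<Sum>z\<in>labelings n. ?p z * log_lik n A z Q) + (\<Sum>z\<in>labelings n. ?p z * (ln (?\<pi> z) - ln (?p z)))"
    by (simp add: var_objective_eq[OF assms(1)] sum.distrib[symmetric] algebra_simps)
  also have "(\<Sum>z\<in>labelings n. ?p z * (ln (?\<pi> z) - ln (?p z))) \<le> (\<Sum>z\<in>labelings n. ?\<pi> z - ?p z)"
    by (rule sum_mono) (rule gibbs)
  also have "\<dots> = 0" by (simp add: sum_subtractf sum\<pi> sum_pmf_product_labels)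
  finally show ?thesis by simp
qed

lemma point_mass_in_var_params: "(\<lambda>i\<in>{..<n}. axis (zs i) 1) \<in> var_params n"
  by (auto simp: var_params_def prob_vector_def axis_def)

text \<open>
  The competitor to the estimate. Uniform class probabilities, in place of the true ones, make the
  loss \<open>n ln k\<close> independent of \<open>\<alpha>\<close>, and therefore also the constant of the theorem.
\<close>

lemma var_objective_point_mass:
  fixes zs :: "nat \<Rightarrow> 'k::finite"
  assumes zs: "zs \<in> labelings n" and \<alpha>: "\<And>a. \<alpha> $ a = 1 / real CARD('k)"
  shows "var_objective n A (\<lambda>i\<in>{..<n}. axis (zs i) 1) \<alpha> Q = log_lik n A zs Q - real n * ln (real CARD('k))"
proof -
  let ?\<tau> = "(\<lambda>i\<in>{..<n}. axis (zs i) 1) :: nat \<Rightarrow> real ^ 'k"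
  note \<tau> = point_mass_in_var_params[where n = n and zs = zs]
  have p: "pmf (product_labels n ?\<tau>) z = of_bool (z = zs)" if "z \<in> labelings n" for z
  proof (cases "z = zs")
    case True
    have "pmf (product_labels n ?\<tau>) z = (\<Prod>i<n. ?\<tau> i $ z i)"
      by (rule pmf_product_labels[OF \<tau> that])
    also have "\<dots> = 1" using True by (intro prod.neutral) (auto simp: axis_def)
    also have "1 = of_bool (z = zs)" by (simp only: True of_bool_eq refl)
    finally show ?thesis .
  next
    case False
    moreover have "z = zs" if "\<And>i. i < n \<Longrightarrow> z i = zs i"
      using \<open>z \<in> labelings n\<close> zs that unfolding labelings_def by (rule PiE_ext) auto
    ultimately obtain i where "i < n" "z i \<noteq> zs i" by blast
    have "pmf (product_labels n ?\<tau>) z = (\<Prod>i<n. ?\<tau> i $ z i)"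
      by (rule pmf_product_labels[OF \<tau> that])
    also have "\<dots> = 0"
      using \<open>i < n\<close> \<open>z i \<noteq> zs i\<close> by (intro prod_zero) (auto simp: axis_def)
    also have "0 = of_bool (z = zs)" using False by (simp only: of_bool_eq)
    finally show ?thesis .
  qed
  have "var_objective n A ?\<tau> \<alpha> Q = (\<Sum>z\<in>labelings n. if z = zs then ln (\<Prod>i<n. \<alpha> $ zs i) + log_lik n A zs Q else 0)"
    by (subst var_objective_eq) (auto simp: \<alpha> p intro!: sum.cong)
  also have "\<dots> = ln (\<Prod>i<n. \<alpha> $ zs i) + log_lik n A zs Q"
    using zs by (simp add: finite_labelings)
  also have "\<dots> = log_lik n A zs Q - real n * ln (real CARD('k))"
    by (simp add: \<alpha> ln_realpow ln_div power_one_over[symmetric])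
  finally show ?thesis .
qed

text \<open>
  The normalisation in \<^const>\<open>sbm_params\<close> only fixes how \<open>Q\<close> is split into scale and shape, so any
  class probabilities may be combined with any \<open>Q\<close>.
\<close>

lemma uniform_in_sbm_params:
  fixes Q :: "real ^ 'k ^ 'k"
  assumes "\<And>a b. 0 < Q $ a $ b \<and> Q $ a $ b < 1" "transpose Q = Q"
  shows "((\<chi> a. 1 / real CARD('k)), Q) \<in> sbm_params"
proof -
  define \<alpha> :: "real ^ 'k" where "\<alpha> = (\<chi> a. 1 / real CARD('k))"
  define r where "r = (\<Sum>a\<in>UNIV. \<Sum>b\<in>UNIV. \<alpha> $ a * \<alpha> $ b * Q $ a $ b)"
  have r: "0 < r" unfolding r_def using assms(1) by (intro sum_pos) (auto simp: \<alpha>_def)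
  have "normalized \<alpha> ((1 / r) *\<^sub>R Q)"
  proof -
    have "(\<Sum>a\<in>UNIV. \<Sum>b\<in>UNIV. \<alpha> $ a * \<alpha> $ b * ((1 / r) *\<^sub>R Q) $ a $ b)
        = (\<Sum>a\<in>UNIV. \<Sum>b\<in>UNIV. \<alpha> $ a * \<alpha> $ b * Q $ a $ b) / r"
      by (simp add: sum_divide_distrib)
    also have "\<dots> = 1" using r by (simp add: r_def[symmetric])
    finally show ?thesis by (simp add: normalized_def)
  qed
  moreover have "transpose ((1 / r) *\<^sub>R Q) = (1 / r) *\<^sub>R Q"
    by (simp add: vec_eq_iff transpose_def transpose_eq_self_entry[OF assms(2)])
  moreover have "Q = r *\<^sub>R ((1 / r) *\<^sub>R Q)" using r by simp
  ultimately have "\<exists>\<rho> Q'. 0 < \<rho> \<and> Q = \<rho> *\<^sub>R Q' \<and> transpose Q' = Q' \<and> (\<forall>a b. 0 < Q' $ a $ b) \<and> normalized \<alpha> Q'"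
    using r assms(1) by (intro exI[of _ r] exI[of _ "(1 / r) *\<^sub>R Q"]) auto
  moreover have "prob_vector \<alpha>" "\<forall>a. 0 < \<alpha> $ a" by (auto simp: prob_vector_def \<alpha>_def)
  ultimately show ?thesis using assms(1) unfolding sbm_params_def \<alpha>_def by blast
qed

lemma var_estimate_expected_log_lik:
  fixes zs :: "nat \<Rightarrow> 'k::finite" and Q :: "real ^ 'k ^ 'k"
  assumes est: "is_var_estimate n A (\<alpha>, Q, \<tau>)" and zs: "zs \<in> labelings n"
    and Qs: "\<And>a b. 0 < Qs $ a $ b \<and> Qs $ a $ b < 1" "transpose Qs = Qs"
  shows "log_lik n A zs Qs - real n * ln (real CARD('k)) \<le>
     (\<Sum>z\<in>labelings n. pmf (product_labels n \<tau>) z * log_lik n A z Q)"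
proof -
  let ?u = "(\<chi> a. 1 / real CARD('k)) :: real ^ 'k"
  let ?d = "(\<lambda>i\<in>{..<n}. axis (zs i) 1) :: nat \<Rightarrow> real ^ 'k"
  have "(\<alpha>, Q) \<in> sbm_params" using est by (auto simp: is_var_estimate_def is_arg_max_def)
  then have \<alpha>: "\<forall>a. 0 < \<alpha> $ a" "prob_vector \<alpha>" by (auto simp: sbm_params_def)
  have "(?u, Qs) \<in> sbm_params" by (rule uniform_in_sbm_params[OF Qs])
  moreover have "?d \<in> var_params n" by (rule point_mass_in_var_params)
  ultimately have "var_objective n A ?d ?u Qs \<le> var_objective n A \<tau> \<alpha> Q"
    using est[unfolded is_var_estimate_def is_arg_max_linorder, THEN conjunct2, rule_format, of "(?u, Qs, ?d)"]
    by simp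
  also have "\<dots> \<le> (\<Sum>z\<in>labelings n. pmf (product_labels n \<tau>) z * log_lik n A z Q)"
    by (rule var_objective_le[OF \<alpha>])
  also have "var_objective n A ?d ?u Qs = log_lik n A zs Qs - real n * ln (real CARD('k))"
    by (rule var_objective_point_mass[OF zs]) simp
  finally show ?thesis .
qed

text \<open>
  Independence of the coordinates of the mean-field law, in the form of a lower bound for a sum over
  labelings.
\<close>

lemma product_labels_pair_prob:
  fixes \<tau> :: "nat \<Rightarrow> real ^ 'k::finite"
  assumes \<tau>: "\<tau> \<in> var_params n" and ij: "i < n" "j < n" "i \<noteq> j"
  shows "\<tau> i $ a * \<tau> j $ b \<le> (\<Sum>z | z \<in> labelings n \<and> z i = a \<and> z j = b. pmf (product_labels n \<tau>) z)"
proof -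
  let ?P = "product_labels n \<tau>"
  define B where "B = (\<lambda>l. if l = i then {a} else if l = j then {b} else UNIV)"
  have pv: "prob_vector (\<tau> l)" if "l < n" for l using \<tau> that by (auto simp: var_params_def)
  have "\<tau> i $ a * \<tau> j $ b = (\<Prod>l\<in>{i, j}. measure_pmf.prob (vec_pmf (\<tau> l)) (B l))"
    using ij pv by (simp add: B_def measure_pmf_single pmf_vec_pmf)
  also have "\<dots> = (\<Prod>l<n. measure_pmf.prob (vec_pmf (\<tau> l)) (B l))"
    using ij by (intro prod.mono_neutral_left) (auto simp: B_def)
  also have "\<dots> = measure_pmf.prob ?P (PiE_dflt {..<n} undefined B)"
    unfolding product_labels_def by (subst measure_Pi_pmf_PiE_dflt) auto
  also have "\<dots> = measure_pmf.prob ?P (PiE_dflt {..<n} undefined B \<inter> labelings n)"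
    using set_product_labels_subset[of n \<tau>]
    by (intro measure_prob_cong_0) (auto simp: set_pmf_iff)
  also have "\<dots> \<le> measure_pmf.prob ?P {z \<in> labelings n. z i = a \<and> z j = b}"
    using ij by (intro measure_pmf.finite_measure_mono) (auto simp: PiE_dflt_def B_def split: if_splits)
  also have "\<dots> = (\<Sum>z | z \<in> labelings n \<and> z i = a \<and> z j = b. pmf ?P z)"
    by (rule measure_measure_pmf_finite) (auto intro: finite_subset[OF _ finite_labelings])
  finally show ?thesis .
qed

lemma mode_ge_inverse_card:
  fixes p :: "real ^ 'k::finite"
  assumes "prob_vector p" "is_arg_max (($) p) (\<lambda>_. True) a"
  shows "1 / real CARD('k) \<le> p $ a"
proof -
  have "1 = (\<Sum>b\<in>UNIV. p $ b)" using assms(1) by (simp add: prob_vector_def)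
  also have "\<dots> \<le> (\<Sum>b\<in>(UNIV :: 'k set). p $ a)"
    using assms(2) by (intro sum_mono) (auto simp: is_arg_max_def not_less)
  finally show ?thesis by (simp add: field_simps)
qed

text \<open>
  The passage from the random labeling of law \<open>\<tau>\<close> to its coordinatewise mode. The squared norm
  is a sum over pairs of nodes, and a pair of distinct nodes receives its modal labels with probability
  at least \<open>1/k\<^sup>2\<close>, the product of the masses of two modes.
\<close>

lemma sq_norm_mode_le:
  fixes \<tau> :: "nat \<Rightarrow> real ^ 'k::finite" and g :: "'k \<Rightarrow> 'k \<Rightarrow> nat \<Rightarrow> nat \<Rightarrow> real"
  assumes \<tau>: "\<tau> \<in> var_params n" and zh: "\<And>i. i < n \<Longrightarrow> is_arg_max (($) (\<tau> i)) (\<lambda>_. True) (zh i)"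
  shows "sq_norm n (\<lambda>i j. g (zh i) (zh j) i j) \<le> (real CARD('k))\<^sup>2 *
    (\<Sum>z\<in>labelings n. pmf (product_labels n \<tau>) z * sq_norm n (\<lambda>i j. g (z i) (z j) i j))"
proof -
  let ?p = "pmf (product_labels n \<tau>)"
  let ?k = "real CARD('k)"
  have pv: "prob_vector (\<tau> i)" if "i < n" for i using \<tau> that by (auto simp: var_params_def)
  have "sq_norm n (\<lambda>i j. g (zh i) (zh j) i j) / ?k\<^sup>2 =
      (\<Sum>(i, j)\<in>node_pairs n. (1 / ?k * (1 / ?k)) * (g (zh i) (zh j) i j)\<^sup>2)"
    by (simp add: sq_norm_def sum_divide_distrib case_prod_unfold power2_eq_square)
  also have "\<dots> \<le> (\<Sum>(i, j)\<in>node_pairs n. \<Sum>z\<in>labelings n. ?p z * (g (z i) (z j) i j)\<^sup>2)"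
  proof (rule sum_mono, safe)
    fix i j assume "(i, j) \<in> node_pairs n"
    then have ij: "i < n" "j < n" "i \<noteq> j" by (auto simp: node_pairs_def)
    let ?S = "{z \<in> labelings n. z i = zh i \<and> z j = zh j}"
    have "1 / ?k * (1 / ?k) \<le> \<tau> i $ zh i * \<tau> j $ zh j"
      using ij pv zh by (intro mult_mono mode_ge_inverse_card) (auto simp: prob_vector_def)
    also have "\<dots> \<le> (\<Sum>z\<in>?S. ?p z)" by (rule product_labels_pair_prob[OF \<tau> ij])
    finally have "1 / ?k * (1 / ?k) * (g (zh i) (zh j) i j)\<^sup>2 \<le> (\<Sum>z\<in>?S. ?p z) * (g (zh i) (zh j) i j)\<^sup>2"
      by (rule mult_right_mono) simp
    also have "\<dots> = (\<Sum>z\<in>?S. ?p z * (g (z i) (z j) i j)\<^sup>2)"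
      by (simp add: sum_distrib_right)
    also have "\<dots> \<le> (\<Sum>z\<in>labelings n. ?p z * (g (z i) (z j) i j)\<^sup>2)"
      by (rule sum_mono2) (auto simp: finite_labelings)
    finally show "1 / ?k * (1 / ?k) * (g (zh i) (zh j) i j)\<^sup>2 \<le> (\<Sum>z\<in>labelings n. ?p z * (g (z i) (z j) i j)\<^sup>2)" .
  qed
  also have "\<dots> = (\<Sum>z\<in>labelings n. ?p z * sq_norm n (\<lambda>i j. g (z i) (z j) i j))"
    unfolding sq_norm_def case_prod_unfold sum_distrib_left by (rule sum.swap)
  finally show ?thesis by (simp add: field_simps)
qed

text \<open>
  The fit of the mode with the estimated \<open>Q\<close>, truncated at \<open>R\<close>. By \<open>L\<close> a large average distance would
  force a small average log-likelihood, which the comparison with the truth excludes.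
\<close>

lemma var_labeling_close:
  fixes zs :: "nat \<Rightarrow> 'k::finite"
  assumes zh: "is_var_labeling n A zh" and zs: "zs \<in> labelings n"
    and Qs: "\<And>a b. 0 < Qs $ a $ b \<and> Qs $ a $ b < 1" "transpose Qs = Qs" and R: "0 < R"
    and L: "\<And>z (Q :: real ^ 'k ^ 'k). z \<in> labelings n \<Longrightarrow> (\<And>a b. 0 < Q $ a $ b \<and> Q $ a $ b < 1) \<Longrightarrow>
       (log_lik n A z Q - log_lik n A zs Qs) / 2
         + sq_norm n (\<lambda>i j. min R (Q $ z i $ z j) - Qs $ zs i $ zs j) / (16 * R) \<le> u"
  obtains Q :: "real ^ 'k ^ 'k" where "transpose Q = Q"
    "sq_norm n (\<lambda>i j. Q $ zh i $ zh j - Qs $ zs i $ zs j) \<le>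
       16 * (real CARD('k))\<^sup>2 * R * (u + real n * ln (real CARD('k)) / 2)"
proof -
  obtain \<alpha> Q \<tau> where est: "is_var_estimate n A (\<alpha>, Q, \<tau>)"
    and mode: "\<And>i. i < n \<Longrightarrow> is_arg_max (($) (\<tau> i)) (\<lambda>_. True) (zh i)"
    using zh by (auto simp: is_var_labeling_def)
  have par: "(\<alpha>, Q) \<in> sbm_params" "\<tau> \<in> var_params n"
    using est by (auto simp: is_var_estimate_def is_arg_max_def)
  then have Q: "\<And>a b. 0 < Q $ a $ b \<and> Q $ a $ b < 1" by (auto simp: sbm_params_def)
  from par obtain r Q' where "Q = r *\<^sub>R Q'" "transpose Q' = Q'" by (auto simp: sbm_params_def)
  then have sym: "Q $ a $ b = Q $ b $ a" for a b
    using transpose_eq_self_entry[of Q' a b] by simp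
  let ?p = "pmf (product_labels n \<tau>)"
  let ?D = "\<lambda>z. sq_norm n (\<lambda>i j. min R (Q $ z i $ z j) - Qs $ zs i $ zs j)"
  let ?k = "real CARD('k)"
  have "(\<Sum>z\<in>labelings n. ?p z * ((log_lik n A z Q - log_lik n A zs Qs) / 2 + ?D z / (16 * R)))
      \<le> (\<Sum>z\<in>labelings n. ?p z * u)"
    by (intro sum_mono mult_left_mono L Q) auto
  also have "\<dots> = u" by (simp add: sum_distrib_right[symmetric] sum_pmf_product_labels)
  also have "(\<Sum>z\<in>labelings n. ?p z * ((log_lik n A z Q - log_lik n A zs Qs) / 2 + ?D z / (16 * R))) =
     ((\<Sum>z\<in>labelings n. ?p z * log_lik n A z Q) - log_lik n A zs Qs * (\<Sum>z\<in>labelings n. ?p z)) / 2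
      + (\<Sum>z\<in>labelings n. ?p z * ?D z) / (16 * R)"
    by (simp add: sum_distrib_left sum_subtractf[symmetric] sum.distrib[symmetric] sum_divide_distrib
      diff_divide_distrib algebra_simps)
  also have "\<dots> = ((\<Sum>z\<in>labelings n. ?p z * log_lik n A z Q) - log_lik n A zs Qs) / 2
      + (\<Sum>z\<in>labelings n. ?p z * ?D z) / (16 * R)"
    by (simp add: sum_pmf_product_labels)
  finally have "((\<Sum>z\<in>labelings n. ?p z * log_lik n A z Q) - log_lik n A zs Qs) / 2
      + (\<Sum>z\<in>labelings n. ?p z * ?D z) / (16 * R) \<le> u" .
  moreover have "d \<le> u + y / 2" if "(s - l) / 2 + d \<le> u" "l - y \<le> s" for s l d y :: real
    using that by argo
  ultimately have "(\<Sum>z\<in>labelings n. ?p z * ?D z) / (16 * R) \<le> u + real n * ln ?k / 2"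
    using var_estimate_expected_log_lik[OF est zs Qs] by blast
  then have E: "(\<Sum>z\<in>labelings n. ?p z * ?D z) \<le> 16 * R * (u + real n * ln ?k / 2)"
    using R by (simp add: field_simps)
  have "?D zh \<le> ?k\<^sup>2 * (\<Sum>z\<in>labelings n. ?p z * ?D z)"
    using sq_norm_mode_le[OF par(2) mode, where g = "\<lambda>a b i j. min R (Q $ a $ b) - Qs $ zs i $ zs j"] by simp
  also have "\<dots> \<le> ?k\<^sup>2 * (16 * R * (u + real n * ln ?k / 2))" by (rule mult_left_mono[OF E]) simp
  finally have D: "?D zh \<le> 16 * ?k\<^sup>2 * R * (u + real n * ln ?k / 2)" by (simp only: mult_ac)
  show thesis
  proof (rule that)
    show "transpose (\<chi> a b. min R (Q $ a $ b)) = (\<chi> a b. min R (Q $ a $ b))"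
      by (simp add: transpose_def vec_eq_iff sym)
    show "sq_norm n (\<lambda>i j. (\<chi> a b. min R (Q $ a $ b)) $ zh i $ zh j - Qs $ zs i $ zs j) \<le>
       16 * ?k\<^sup>2 * R * (u + real n * ln ?k / 2)"
      using D by simp
  qed
qed

section \<open>Concentration of class sizes and of block sums\<close>

lemma class_size_tail:
  fixes \<alpha> :: "real ^ 'k::finite"
  assumes \<alpha>: "prob_vector \<alpha>"
  shows "measure_pmf.prob (product_labels n (\<lambda>_. \<alpha>)) {z. real (card (block n z a)) < \<alpha> $ a * real n / 2}
    \<le> exp (- ((1 / 2 - exp (-1)) * \<alpha> $ a * real n))"
proof -
  define c :: real where "c = 1 - exp (-1)"
  \<comment> \<open>exponential moments of minus the class size; the rate is positive because \<open>1/2 < 1 - 1/e\<close>\<close>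
  define f where "f = (\<lambda>(i::nat) x. c * \<alpha> $ a - of_bool (x = a))"
  have "measure_pmf.prob (product_labels n (\<lambda>_. \<alpha>)) {z. real (card (block n z a)) < \<alpha> $ a * real n / 2}
     \<le> measure_pmf.prob (product_labels n (\<lambda>_. \<alpha>)) {z. (1 / 2 - exp (-1)) * \<alpha> $ a * real n \<le> (\<Sum>i<n. f i (z i))}"
  proof (rule measure_pmf.finite_measure_mono)
    have eq: "(\<Sum>i<n. f i (z i)) = c * \<alpha> $ a * real n - real (card (block n z a))" for z
    proof -
      have "(\<Sum>i<n. of_bool (z i = a)) = real (card (block n z a))"
        by (simp add: of_bool_def sum.If_cases block_def Int_def)
      then show ?thesis by (simp add: f_def sum_subtractf)
    qed
    show "{z. real (card (block n z a)) < \<alpha> $ a * real n / 2} \<subseteq>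
       {z. (1 / 2 - exp (-1)) * \<alpha> $ a * real n \<le> (\<Sum>i<n. f i (z i))}"
    proof safe
      fix z assume "real (card (block n z a)) < \<alpha> $ a * real n / 2"
      then show "(1 / 2 - exp (-1)) * \<alpha> $ a * real n \<le> (\<Sum>i<n. f i (z i))"
        unfolding eq by (simp add: c_def algebra_simps)
    qed
  qed simp
  also have "\<dots> \<le> exp (- ((1 / 2 - exp (-1)) * \<alpha> $ a * real n))"
    unfolding product_labels_def
  proof (rule Pi_pmf_exp_Markov)
    fix i
    have "exp (f i x) = exp (c * \<alpha> $ a) * (1 - c * indicator {a} x)" for x
    proof -
      have "exp (f i x) = exp (c * \<alpha> $ a) * exp (- of_bool (x = a))"
        unfolding f_def by (simp add: exp_diff exp_minus divide_inverse)
      also have "exp (- of_bool (x = a)) = 1 - c * indicator {a} x"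
        by (auto simp: c_def indicator_def)
      finally show ?thesis .
    qed
    then have "measure_pmf.expectation (vec_pmf \<alpha>) (\<lambda>x. exp (f i x)) =
       exp (c * \<alpha> $ a) * measure_pmf.expectation (vec_pmf \<alpha>) (\<lambda>x. 1 - c * indicator {a} x)"
      by simp
    also have "measure_pmf.expectation (vec_pmf \<alpha>) (\<lambda>x. 1 - c * indicator {a} x) = 1 - c * \<alpha> $ a"
      by (subst Bochner_Integration.integral_diff)
        (auto intro: integrable_measure_pmf_finite simp: measure_pmf_single pmf_vec_pmf[OF \<alpha>])
    also have "exp (c * \<alpha> $ a) * (1 - c * \<alpha> $ a) \<le> exp (c * \<alpha> $ a) * exp (- (c * \<alpha> $ a))"
      using exp_ge_add_one_self[of "- (c * \<alpha> $ a)"] by (intro mult_left_mono) auto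
    finally show "measure_pmf.expectation (vec_pmf \<alpha>) (\<lambda>x. exp (f i x)) \<le> 1"
      by (simp add: exp_minus)
  qed auto
  finally show ?thesis .
qed

text \<open>
  Labels are estimated from the same data, so the block sums are bounded for all labelings at once;
  a threshold \<open>v\<close> of order \<open>n\<close> compensates their number \<open>k\<^sup>n\<close>.
\<close>

lemma noise_tail_uniform:
  fixes Qs :: "real ^ 'k ^ 'k"
  assumes Qs: "\<And>a b. 0 < Qs $ a $ b \<and> Qs $ a $ b < 1 \<and> Qs $ a $ b \<le> R" and v: "0 \<le> v"
  shows "measure_pmf.prob (edges n zs Qs)
     {e. \<exists>z\<in>labelings n. \<exists>a b :: 'k. v \<le> 4 * real (card (pair_block n z a b)) * R \<and>
        v * real (card (pair_block n z a b)) * R <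
          (\<Sum>(i, j)\<in>pair_block n z a b. of_bool (e (i, j)) - Qs $ zs i $ zs j)\<^sup>2}
    \<le> real CARD('k) ^ n * (2 * (real CARD('k))\<^sup>2 * exp (- v / 4))"
proof -
  have R: "0 < R" using Qs[of undefined undefined] by linarith
  let ?T = "(labelings n :: (nat \<Rightarrow> 'k) set) \<times> (UNIV :: ('k \<times> 'k) set)"
  define bad where "bad = (\<lambda>e (z, a :: 'k, b). v \<le> 4 * real (card (pair_block n z a b)) * R \<and>
      v * real (card (pair_block n z a b)) * R <
        (\<Sum>(i, j)\<in>pair_block n z a b. of_bool (e (i, j)) - Qs $ zs i $ zs j)\<^sup>2)"
  have "{e. \<exists>z\<in>labelings n. \<exists>a b :: 'k. v \<le> 4 * real (card (pair_block n z a b)) * R \<and>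
        v * real (card (pair_block n z a b)) * R <
          (\<Sum>(i, j)\<in>pair_block n z a b. of_bool (e (i, j)) - Qs $ zs i $ zs j)\<^sup>2}
     = {e. \<exists>y\<in>?T. bad e y}" by (auto simp: bad_def)
  also have "measure_pmf.prob (edges n zs Qs) \<dots> \<le> real (card ?T) * (2 * exp (- v / 4))"
  proof (rule prob_Ex_le_card)
    show "finite ?T" by (intro finite_cartesian_product finite_labelings) simp
    fix y :: "(nat \<Rightarrow> 'k) \<times> 'k \<times> 'k"
    obtain z a b where y: "y = (z, a, b)" by (cases y)
    let ?P = "pair_block n z a b"
    show "measure_pmf.prob (edges n zs Qs) {e. bad e y} \<le> 2 * exp (- v / 4)"
    proof (cases "v \<le> 4 * real (card ?P) * R")
      case True
      have p: "0 \<le> (case x of (i, j) \<Rightarrow> Qs $ zs i $ zs j) \<and> (case x of (i, j) \<Rightarrow> Qs $ zs i $ zs j) \<le> 1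
          \<and> (case x of (i, j) \<Rightarrow> Qs $ zs i $ zs j) \<le> R" for x
        using Qs by (cases x) (auto simp: less_imp_le)
      have "measure_pmf.prob (edges n zs Qs) {e. bad e y} =
        measure_pmf.prob (Pi_pmf (node_pairs n) False (\<lambda>x. bernoulli_pmf (case x of (i, j) \<Rightarrow> Qs $ zs i $ zs j)))
         {e. v * real (card ?P) * R < (\<Sum>x\<in>?P. of_bool (e x) - (case x of (i, j) \<Rightarrow> Qs $ zs i $ zs j))\<^sup>2}"
        using True by (simp add: edges_def bad_def y case_prod_unfold)
      also have "\<dots> \<le> 2 * exp (- v / 4)"
        by (rule bernoulli_sum_tail[OF finite_node_pairs pair_block_subset p R v True])
      finally show ?thesis .
    qed (simp add: bad_def y)
  qed
  also have "real (card ?T) = real CARD('k) ^ n * (real CARD('k))\<^sup>2"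
    by (simp add: card_cartesian_product card_labelings power2_eq_square)
  finally show ?thesis by (simp add: mult_ac)
qed

section \<open>The error of the variational estimator of the connection probabilities\<close>

text \<open>
  The deterministic part of the argument. Each of the \<open>k\<^sup>2\<close> blocks of the estimated labeling
  contributes a bias, bounded by the whole distance \<open>B\<close> of the fit with \<open>Q\<close>, and a noise term, bounded
  by \<open>v R\<close> once the blocks are known to be large.
\<close>

lemma var_conn_probs_close:
  fixes zs zh :: "nat \<Rightarrow> 'k::finite" and Qs :: "real ^ 'k ^ 'k"
  assumes zh: "is_var_labeling n (adjacency e) zh" and zs: "zs \<in> labelings n"
    and diag: "\<And>i. \<not> e (i, i)"
    and Qs: "\<And>a b. 0 < Qs $ a $ b \<and> Qs $ a $ b < 1" "transpose Qs = Qs" and R: "0 < R"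
    and L: "\<And>z (Q :: real ^ 'k ^ 'k). z \<in> labelings n \<Longrightarrow> (\<And>a b. 0 < Q $ a $ b \<and> Q $ a $ b < 1) \<Longrightarrow>
       (log_lik n (adjacency e) z Q - log_lik n (adjacency e) zs Qs) / 2
         + sq_norm n (\<lambda>i j. min R (Q $ z i $ z j) - Qs $ zs i $ zs j) / (16 * R) \<le> u"
    and B: "16 * (real CARD('k))\<^sup>2 * R * (u + real n * ln (real CARD('k)) / 2) \<le> B"
    and gap: "\<And>a b. a \<noteq> b \<Longrightarrow> \<exists>d. g \<le> \<bar>Qs $ d $ a - Qs $ d $ b\<bar>" "0 < g"
    and classes: "\<And>a. real CARD('k) * m \<le> real (card (block n zs a))"
    and m: "2 \<le> m" "16 * B < g\<^sup>2 * m\<^sup>2"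
    and v: "0 \<le> v" "v \<le> m\<^sup>2 * R"
    and W: "\<And>a b. v \<le> 4 * real (card (pair_block n zh a b)) * R \<Longrightarrow>
       (\<Sum>(i, j)\<in>pair_block n zh a b. of_bool (e (i, j)) - Qs $ zs i $ zs j)\<^sup>2
         \<le> v * real (card (pair_block n zh a b)) * R"
  shows "sq_norm n (\<lambda>i j. conn_probs zs Qs i j - var_conn_probs n (adjacency e) zh i j)
    \<le> (real CARD('k))\<^sup>2 * (B + v * R)"
proof -
  obtain Q :: "real ^ 'k ^ 'k" where Q: "transpose Q = Q"
    "sq_norm n (\<lambda>i j. Q $ zh i $ zh j - Qs $ zs i $ zs j) \<le>
       16 * (real CARD('k))\<^sup>2 * R * (u + real n * ln (real CARD('k)) / 2)"
    using var_labeling_close[OF zh zs Qs R L] by blast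
  let ?D = "sq_norm n (\<lambda>i j. Q $ zh i $ zh j - Qs $ zs i $ zs j)"
  have symQ: "Q $ a $ b = Q $ b $ a" for a b by (rule transpose_eq_self_entry[OF Q(1)])
  have D: "?D \<le> B" using Q(2) B by linarith
  have large: "m \<le> real (card (block n zh c))" for c
    by (rule blocks_large_if_close[OF Q(1) Qs(2) gap(1) classes m(1) gap(2)]) (use D m(2) in auto)
  let ?X = "block_means n (adjacency e) zh"
  define \<theta> where "\<theta> = (\<lambda>(i, j). Qs $ zs i $ zs j)"
  define A where "A = (\<lambda>(i, j). adjacency e i j)"
  define F where "F = (\<lambda>x. (\<theta> x - ?X $ zh (fst x) $ zh (snd x))\<^sup>2)"
  have adj: "adjacency e i j = adjacency e j i" "adjacency e i i = 0" for i j
    using diag by (simp_all add: adjacency_def min.commute max.commute)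
  have block: "(\<Sum>x\<in>{x \<in> node_pairs n. (zh (fst x), zh (snd x)) = y}. F x) \<le> B + v * R" for y
  proof -
    obtain a b where y: "y = (a, b)" by (cases y)
    let ?P = "pair_block n zh a b"
    let ?N = "real (card ?P)"
    have X: "?X $ a $ b = (\<Sum>x\<in>?P. A x) / ?N"
      unfolding A_def by (rule block_means_eq_average) (rule adj)+
    have N: "m\<^sup>2 / 4 \<le> ?N" by (rule card_pair_block_ge[OF large m(1)])
    moreover have "0 < m\<^sup>2" using m(1) by simp
    ultimately have Npos: "0 < ?N" by linarith
    have "m\<^sup>2 * R \<le> 4 * ?N * R" using N R by (intro mult_right_mono) auto
    then have "(\<Sum>(i, j)\<in>?P. of_bool (e (i, j)) - Qs $ zs i $ zs j)\<^sup>2 \<le> v * ?N * R"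
      using v by (intro W) auto
    also have "(\<Sum>(i, j)\<in>?P. of_bool (e (i, j)) - Qs $ zs i $ zs j) = (\<Sum>x\<in>?P. A x - \<theta> x)"
      by (rule sum.cong) (auto simp: A_def \<theta>_def pair_block_def adjacency_node_pairs)
    finally have W': "(\<Sum>x\<in>?P. A x - \<theta> x)\<^sup>2 / ?N \<le> v * R"
      using Npos by (simp add: field_simps)
    have "(\<Sum>x\<in>{x \<in> node_pairs n. (zh (fst x), zh (snd x)) = y}. F x) =
      (\<Sum>x\<in>{x \<in> node_pairs n. (zh (fst x), zh (snd x)) = y}. (\<theta> x - (\<Sum>x\<in>?P. A x) / ?N)\<^sup>2)"
      by (rule sum.cong) (auto simp: F_def y X)
    also have "\<dots> \<le> (\<Sum>x\<in>?P. (\<theta> x - (\<Sum>x\<in>?P. A x) / ?N)\<^sup>2)"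
      by (rule sum_mono2[OF finite_pair_block]) (auto simp: pair_block_def y)
    also have "\<dots> \<le> (\<Sum>x\<in>?P. (\<theta> x - Q $ a $ b)\<^sup>2) + (\<Sum>x\<in>?P. A x - \<theta> x)\<^sup>2 / ?N"
      by (rule sum_sq_dev_average_le) simp
    also have "(\<Sum>x\<in>?P. (\<theta> x - Q $ a $ b)\<^sup>2) = (\<Sum>(i, j)\<in>?P. (Q $ zh i $ zh j - Qs $ zs i $ zs j)\<^sup>2)"
      by (rule sum.cong)
        (auto simp: \<theta>_def pair_block_def power2_commute[of _ "Q $ a $ b"] symQ)
    also have "\<dots> \<le> ?D"
      unfolding sq_norm_def by (rule sum_mono2) (auto simp: pair_block_subset[THEN subsetD])
    finally show ?thesis using W' D by linarith
  qed
  have "sq_norm n (\<lambda>i j. conn_probs zs Qs i j - var_conn_probs n (adjacency e) zh i j) = (\<Sum>x\<in>node_pairs n. F x)"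
    unfolding sq_norm_def
    by (rule sum.cong) (auto simp: F_def \<theta>_def conn_probs_def var_conn_probs_def node_pairs_def)
  also have "\<dots> = (\<Sum>y\<in>UNIV. \<Sum>x\<in>{x \<in> node_pairs n. (zh (fst x), zh (snd x)) = y}. F x)"
    by (rule sum.group[symmetric]) auto
  also have "\<dots> \<le> (\<Sum>y\<in>(UNIV :: ('k \<times> 'k) set). B + v * R)"
    by (rule sum_mono) (rule block)
  finally show ?thesis by (simp add: power2_eq_square)
qed

lemma power_times_exp_ln:
  assumes "0 < k"
  shows "real k ^ n * exp (- (real n * ln (real k) + s)) = exp (- s)"
proof -
  have "exp (real n * ln (real k)) = real k ^ n"
    using assms by (simp add: exp_of_nat_mult)
  then show ?thesis using assms by (simp add: exp_add exp_minus exp_diff field_simps)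
qed

text \<open>
  The three error terms come from atypical class sizes, from the likelihood ratios and from the block
  sums. The thresholds are such that the \<open>k\<^sup>n\<close> of the union bounds cancels and
  \<open>exp (- n)\<close> is left.
\<close>

lemma var_conn_probs_prob:
  fixes Qs :: "real ^ 'k ^ 'k" and \<alpha> :: "real ^ 'k"
  assumes \<alpha>: "prob_vector \<alpha>" and n: "0 < n" "1 \<le> real n * R"
    and Qs: "\<And>a b. 0 < Qs $ a $ b \<and> Qs $ a $ b < 1 \<and> Qs $ a $ b \<le> R" "transpose Qs = Qs"
    and gap: "\<And>a b. a \<noteq> b \<Longrightarrow> \<exists>d. g \<le> \<bar>Qs $ d $ a - Qs $ d $ b\<bar>" "0 < g"
    and B: "16 * (real CARD('k))\<^sup>2 * R * (3 / 2 * real n * ln (real CARD('k)) + real n + 1) \<le> B"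
    and m: "\<And>a. real CARD('k) * m \<le> \<alpha> $ a * real n / 2" "2 \<le> m" "16 * B < g\<^sup>2 * m\<^sup>2"
    and v: "v = 4 * (real n * ln (real CARD('k)) + real n)" "v \<le> m\<^sup>2 * R"
  shows "1 - ((\<Sum>a\<in>UNIV. exp (- ((1 / 2 - exp (-1)) * \<alpha> $ a * real n)))
       + (real n ^ (2 * CARD('k)\<^sup>2) + 2 * (real CARD('k))\<^sup>2) * exp (- real n))
    \<le> measure_pmf.prob (sbm n \<alpha> Qs)
        {(z, A). \<forall>zh :: nat \<Rightarrow> 'k. is_var_labeling n A zh \<longrightarrow>
           sq_norm n (\<lambda>i j. conn_probs z Qs i j - var_conn_probs n A zh i j)
             \<le> (real CARD('k))\<^sup>2 * (B + v * R)}" (is "1 - (?d1 + ?d2) \<le> measure_pmf.prob _ ?G")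
proof -
  let ?k = "real CARD('k)"
  have R: "0 < R" using Qs(1)[of undefined undefined] by linarith
  have lnk: "0 \<le> ln ?k" by simp
  have v0: "0 \<le> v" unfolding v using lnk by simp
  define t where "t = real n * ln ?k + real n"
  define small where "small = {z :: nat \<Rightarrow> 'k. \<exists>a. real (card (block n z a)) < \<alpha> $ a * real n / 2}"
  have small: "measure_pmf.prob (product_labels n (\<lambda>_. \<alpha>)) small \<le> ?d1"
  proof -
    have "small = (\<Union>a\<in>UNIV. {z. real (card (block n z a)) < \<alpha> $ a * real n / 2})"
      by (auto simp: small_def)
    then have "measure_pmf.prob (product_labels n (\<lambda>_. \<alpha>)) small \<le>
       (\<Sum>a\<in>UNIV. measure_pmf.prob (product_labels n (\<lambda>_. \<alpha>)) {z. real (card (block n z a)) < \<alpha> $ a * real n / 2})"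
      by (simp add: measure_pmf.finite_measure_subadditive_finite)
    also have "\<dots> \<le> ?d1" by (rule sum_mono) (rule class_size_tail[OF \<alpha>])
    finally show ?thesis .
  qed
  have cond: "measure_pmf.prob (map_pmf (\<lambda>e. (zs, adjacency e)) (edges n zs Qs)) (- ?G) \<le> ?d2"
    if zs: "zs \<in> set_pmf (product_labels n (\<lambda>_. \<alpha>))" "zs \<notin> small" for zs
  proof -
    have zsl: "zs \<in> labelings n" using zs(1) set_product_labels_subset by blast
    define E1 where "E1 = {e. \<exists>z\<in>labelings n. \<exists>Q :: real ^ 'k ^ 'k. (\<forall>a b. 0 < Q $ a $ b \<and> Q $ a $ b < 1) \<and>
        t + 1 \<le> (log_lik n (adjacency e) z Q - log_lik n (adjacency e) zs Qs) / 2
            + sq_norm n (\<lambda>i j. min R (Q $ z i $ z j) - Qs $ zs i $ zs j) / (16 * R)}"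
    define E2 where "E2 = {e. \<exists>z\<in>labelings n. \<exists>a b :: 'k. v \<le> 4 * real (card (pair_block n z a b)) * R \<and>
        v * real (card (pair_block n z a b)) * R <
          (\<Sum>(i, j)\<in>pair_block n z a b. of_bool (e (i, j)) - Qs $ zs i $ zs j)\<^sup>2}"
    have sub: "e \<in> E1 \<union> E2" if e: "e \<in> set_pmf (edges n zs Qs)" "(zs, adjacency e) \<notin> ?G" for e
    proof (rule ccontr)
      assume not: "e \<notin> E1 \<union> E2"
      have diag: "\<not> e (i, i)" for i
        using e(1) set_Pi_pmf_subset[OF finite_node_pairs] unfolding edges_def
        by (force simp: node_pairs_def)
      obtain zh :: "nat \<Rightarrow> 'k" where zh: "is_var_labeling n (adjacency e) zh" and
        far: "\<not> sq_norm n (\<lambda>i j. conn_probs zs Qs i j - var_conn_probs n (adjacency e) zh i j) \<le> ?k\<^sup>2 * (B + v * R)"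
        using e(2) by auto
      have zhl: "zh \<in> labelings n" using zh by (simp add: is_var_labeling_def)
      have "sq_norm n (\<lambda>i j. conn_probs zs Qs i j - var_conn_probs n (adjacency e) zh i j) \<le> ?k\<^sup>2 * (B + v * R)"
      proof (rule var_conn_probs_close[OF zh zsl diag _ Qs(2) R])
        show "0 < Qs $ a $ b \<and> Qs $ a $ b < 1" for a b using Qs(1) by auto
        show "(log_lik n (adjacency e) z Q - log_lik n (adjacency e) zs Qs) / 2
            + sq_norm n (\<lambda>i j. min R (Q $ z i $ z j) - Qs $ zs i $ zs j) / (16 * R) \<le> t + 1"
          if "z \<in> labelings n" "\<And>a b. 0 < Q $ a $ b \<and> Q $ a $ b < 1" for z and Q :: "real ^ 'k ^ 'k"
        proof -
          have "\<not> t + 1 \<le> (log_lik n (adjacency e) z Q - log_lik n (adjacency e) zs Qs) / 2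
            + sq_norm n (\<lambda>i j. min R (Q $ z i $ z j) - Qs $ zs i $ zs j) / (16 * R)"
            using not that unfolding E1_def by blast
          then show ?thesis by (simp only: not_le less_imp_le)
        qed
        show "16 * ?k\<^sup>2 * R * (t + 1 + real n * ln ?k / 2) \<le> B"
          using B by (simp add: t_def algebra_simps)
        show "?k * m \<le> real (card (block n zs a))" for a
        proof -
          have "\<not> real (card (block n zs a)) < \<alpha> $ a * real n / 2"
            using zs(2) unfolding small_def by blast
          then show ?thesis using m(1)[of a] by linarith
        qed
        show "(\<Sum>(i, j)\<in>pair_block n zh a b. of_bool (e (i, j)) - Qs $ zs i $ zs j)\<^sup>2
            \<le> v * real (card (pair_block n zh a b)) * R"
          if "v \<le> 4 * real (card (pair_block n zh a b)) * R" for a b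
        proof (rule ccontr)
          assume "\<not> ?thesis"
          then have "e \<in> E2" unfolding E2_def using that zhl by (auto simp only: not_le mem_Collect_eq)
          then show False using not by simp
        qed
      qed (use gap m v v0 in auto)
      then show False using far by simp
    qed
    have "measure_pmf.prob (map_pmf (\<lambda>e. (zs, adjacency e)) (edges n zs Qs)) (- ?G) =
       measure_pmf.prob (edges n zs Qs) {e. (zs, adjacency e) \<notin> ?G}"
      by (simp add: vimage_def)
    also have "\<dots> \<le> measure_pmf.prob (edges n zs Qs) (E1 \<union> E2)"
      using sub by (intro measure_pmf.finite_measure_mono_AE) (auto simp: AE_measure_pmf_iff)
    also have "\<dots> \<le> measure_pmf.prob (edges n zs Qs) E1 + measure_pmf.prob (edges n zs Qs) E2"
      by (rule measure_Un_le) auto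
    also have "\<dots> \<le> ?k ^ n * real n ^ (2 * CARD('k)\<^sup>2) * exp (- t) + ?k ^ n * (2 * ?k\<^sup>2 * exp (- v / 4))"
      unfolding E1_def E2_def
      by (intro add_mono likelihood_ratio_tail_uniform noise_tail_uniform Qs n v0)
    also have "exp (- v / 4) = exp (- t)" by (simp add: v t_def)
    also have "?k ^ n * real n ^ (2 * CARD('k)\<^sup>2) * exp (- t) + ?k ^ n * (2 * ?k\<^sup>2 * exp (- t)) =
       (real n ^ (2 * CARD('k)\<^sup>2) + 2 * ?k\<^sup>2) * (?k ^ n * exp (- t))" by (simp only: ring_distribs mult_ac)
    also have "?k ^ n * exp (- t) = exp (- real n)"
      unfolding t_def by (rule power_times_exp_ln) simp
    finally show ?thesis .
  qed
  have "measure_pmf.prob (sbm n \<alpha> Qs) (- ?G) \<le> measure_pmf.prob (product_labels n (\<lambda>_. \<alpha>)) small + ?d2"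
    unfolding sbm_def edges_def[symmetric] by (rule measure_bind_pmf_le[OF cond]) auto
  also have "\<dots> \<le> ?d1 + ?d2" using small by simp
  finally have "measure_pmf.prob (sbm n \<alpha> Qs) (- ?G) \<le> ?d1 + ?d2" .
  then show ?thesis using measure_pmf.prob_compl[of ?G "sbm n \<alpha> Qs"] by (simp add: Compl_eq_Diff_UNIV)
qed

lemma failure_prob_tendsto_0:
  fixes \<alpha> :: "real ^ 'k"
  assumes "\<forall>a. 0 < \<alpha> $ a"
  shows "(\<lambda>n. (\<Sum>a\<in>UNIV. exp (- ((1 / 2 - exp (-1)) * \<alpha> $ a * real n)))
       + (real n ^ p + c) * exp (- real n)) \<longlonglongrightarrow> 0"
proof -
  have "exp 1 > (2 :: real)" using exp_lower_Taylor_quadratic[of "1::real"] by simp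
  then have half: "0 < 1 / 2 - exp (-1 :: real)" by (simp add: exp_minus field_simps)
  have lin: "(\<lambda>n. exp (- (s * real n))) \<longlonglongrightarrow> 0" if "0 < s" for s :: real
  proof -
    have "filterlim (\<lambda>n. s * real n) at_top sequentially"
      by (rule filterlim_tendsto_pos_mult_at_top[OF tendsto_const that filterlim_real_sequentially])
    then show ?thesis
      by (intro filterlim_compose[OF exp_at_bot]) (simp add: filterlim_uminus_at_bot)
  qed
  have pow: "(\<lambda>n. real n ^ q * exp (- real n)) \<longlonglongrightarrow> 0" for q
    using filterlim_compose[OF tendsto_power_div_exp_0 filterlim_real_sequentially, of q]
    by (simp add: exp_minus field_simps)
  have "(\<lambda>n. (\<Sum>a\<in>UNIV. exp (- ((1 / 2 - exp (-1)) * \<alpha> $ a * real n)))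
       + (real n ^ p * exp (- real n) + c * (real n ^ 0 * exp (- real n)))) \<longlonglongrightarrow> (\<Sum>a\<in>(UNIV :: 'k set). 0) + (0 + c * 0)"
    by (intro tendsto_add tendsto_sum tendsto_mult tendsto_const lin pow mult_pos_pos half) (use assms in auto)
  then show ?thesis by (simp add: ring_distribs)
qed


lemma column_gap:
  fixes Q :: "real ^ 'k ^ 'k"
  assumes "\<forall>a b. a \<noteq> b \<longrightarrow> column a Q \<noteq> column b Q"
  obtains g where "0 < g" "\<And>a b. a \<noteq> b \<Longrightarrow> \<exists>d. g \<le> \<bar>Q $ d $ a - Q $ d $ b\<bar>"
proof -
  define S where "S = (\<lambda>(d, a, b). \<bar>Q $ d $ a - Q $ d $ b\<bar>) ` UNIV"
  define g where "g = Min (insert 1 {x \<in> S. 0 < x})"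
  have fin: "finite (insert 1 {x \<in> S. 0 < x})" by (simp add: S_def)
  show thesis
  proof (rule that)
    have "g \<in> insert 1 {x \<in> S. 0 < x}" unfolding g_def by (rule Min_in[OF fin]) simp
    then show "0 < g" by auto
    fix a b :: 'k assume "a \<noteq> b"
    then obtain d where d: "Q $ d $ a \<noteq> Q $ d $ b"
      using assms by (force simp: column_def vec_eq_iff)
    have "\<bar>Q $ d $ a - Q $ d $ b\<bar> \<in> S" unfolding S_def by (rule image_eqI[of _ _ "(d, a, b)"]) auto
    then have "g \<le> \<bar>Q $ d $ a - Q $ d $ b\<bar>"
      unfolding g_def using d by (intro Min_le[OF fin]) auto
    then show "\<exists>d. g \<le> \<bar>Q $ d $ a - Q $ d $ b\<bar>" by blast
  qed
qed

lemma expected_degree_at_top: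
  fixes \<rho> :: "nat \<Rightarrow> real"
  assumes "filterlim (\<lambda>n. \<rho> n / (ln (real n) / real n)) at_top sequentially"
  shows "filterlim (\<lambda>n. \<rho> n * real n) at_top sequentially"
proof (rule filterlim_at_top_mono[OF assms])
  have "eventually (\<lambda>n. \<rho> n / (ln (real n) / real n) \<ge> 0) sequentially"
    using assms by (simp add: filterlim_at_top)
  then show "eventually (\<lambda>n. \<rho> n / (ln (real n) / real n) \<le> \<rho> n * real n) sequentially"
    using eventually_ge_at_top[of 3]
  proof eventually_elim
    case (elim n)
    have "1 \<le> ln (real n)"
    proof -
      have "exp 1 \<le> real n" using exp_le elim(2) by linarith
      then show ?thesis using elim(2) by (subst ln_ge_iff) auto
    qed
    moreover have eq: "\<rho> n / (ln (real n) / real n) = (\<rho> n * real n) / ln (real n)" by simp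
    ultimately have "0 \<le> \<rho> n * real n" using elim(1) by (simp add: zero_le_divide_iff)
    then have "\<rho> n * real n / ln (real n) \<le> \<rho> n * real n / 1"
      using \<open>1 \<le> ln (real n)\<close> by (intro divide_left_mono) auto
    then show ?case unfolding eq by simp
  qed
qed

theorem proposition3:
  fixes Q0 :: "real ^ 'k ^ 'k"
  assumes "2 \<le> CARD('k)"
    and "transpose Q0 = Q0"
    and "\<forall>a b. 0 < Q0 $ a $ b"
    and "\<forall>a b. a \<noteq> b \<longrightarrow> column a Q0 \<noteq> column b Q0"
  shows "\<exists>C>0. \<forall>(\<alpha>0 :: real ^ 'k) (\<rho> :: nat \<Rightarrow> real).
    (\<forall>a. 0 < \<alpha>0 $ a) \<longrightarrow>
    normalized \<alpha>0 Q0 \<longrightarrow>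
    (\<forall>n. (\<alpha>0, \<rho> n *\<^sub>R Q0) \<in> sbm_params) \<longrightarrow>
    filterlim (\<lambda>n. \<rho> n / (ln (real n) / real n)) at_top sequentially \<longrightarrow>
    (\<lambda>n. measure_pmf.prob (sbm n \<alpha>0 (\<rho> n *\<^sub>R Q0))
       {(z, A). \<forall>zh :: nat \<Rightarrow> 'k. is_var_labeling n A zh \<longrightarrow>
          sq_norm n (\<lambda>i j. conn_probs z (\<rho> n *\<^sub>R Q0) i j - var_conn_probs n A zh i j)
            \<le> C * \<rho> n * ((real CARD('k))\<^sup>2 + real n * ln (real CARD('k)))})
      \<longlonglongrightarrow> 1"
proof -
  define k where "k = real CARD('k)"
  have k: "2 \<le> k" using assms(1) by (simp add: k_def)
  have lnk: "0 < ln k" using k by simp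
  define M where "M = (\<Sum>a\<in>UNIV. \<Sum>b\<in>UNIV. Q0 $ a $ b)"
  have entry_le: "Q0 $ a $ b \<le> M" for a b
  proof -
    have "Q0 $ a $ b \<le> (\<Sum>b\<in>UNIV. Q0 $ a $ b)"
      using assms(3) by (intro member_le_sum) (auto simp: less_imp_le)
    also have "\<dots> \<le> M" unfolding M_def
      using assms(3) by (intro member_le_sum[where f = "\<lambda>a. \<Sum>b\<in>UNIV. Q0 $ a $ b"]) (auto intro!: sum_nonneg simp: less_imp_le)
    finally show ?thesis .
  qed
  have M: "0 < M" using entry_le assms(3) by (meson less_le_trans)
  obtain g where g: "0 < g" "\<And>a b. a \<noteq> b \<Longrightarrow> \<exists>d. g \<le> \<bar>Q0 $ d $ a - Q0 $ d $ b\<bar>"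
    using column_gap[OF assms(4)] by blast
  define K where "K = 16 * k\<^sup>2 * (3 / 2 * ln k + 2)"
  define V where "V = 4 * (ln k + 1)"
  have KV: "0 < K" "0 < V" using k lnk by (auto simp: K_def V_def intro!: mult_pos_pos add_pos_pos)
  \<comment> \<open>division by \<open>ln k\<close> since the bound below is a multiple of \<open>n\<close>, not of \<open>n ln k\<close>\<close>
  define C where "C = k\<^sup>2 * (K + V) * M / ln k"
  have C: "0 < C" unfolding C_def using k lnk M KV by (intro divide_pos_pos mult_pos_pos add_pos_pos) auto
  show ?thesis
  proof (intro exI[of _ C] conjI C allI impI)
    fix \<alpha> :: "real ^ 'k" and \<rho> :: "nat \<Rightarrow> real"
    assume \<alpha>: "\<forall>a. 0 < \<alpha> $ a" and "normalized \<alpha> Q0"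
      and par: "\<forall>n. (\<alpha>, \<rho> n *\<^sub>R Q0) \<in> sbm_params"
      and rate: "filterlim (\<lambda>n. \<rho> n / (ln (real n) / real n)) at_top sequentially"
    let ?G = "\<lambda>n. {(z, A). \<forall>zh :: nat \<Rightarrow> 'k. is_var_labeling n A zh \<longrightarrow>
          sq_norm n (\<lambda>i j. conn_probs z (\<rho> n *\<^sub>R Q0) i j - var_conn_probs n A zh i j)
            \<le> C * \<rho> n * ((real CARD('k))\<^sup>2 + real n * ln (real CARD('k)))}"
    let ?P = "\<lambda>n. measure_pmf.prob (sbm n \<alpha> (\<rho> n *\<^sub>R Q0))"
    let ?\<delta> = "\<lambda>n. (\<Sum>a\<in>UNIV. exp (- ((1 / 2 - exp (-1)) * \<alpha> $ a * real n)))
       + (real n ^ (2 * CARD('k)\<^sup>2) + 2 * (real CARD('k))\<^sup>2) * exp (- real n)"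
    have pv: "prob_vector \<alpha>" using par by (auto simp: sbm_params_def)
    have Qn: "0 < \<rho> n * Q0 $ a $ b" "\<rho> n * Q0 $ a $ b < 1" for n a b
      using par by (auto simp: sbm_params_def)
    have \<rho>: "0 < \<rho> n" for n
      using Qn(1)[of n undefined undefined] assms(3) by (metis zero_less_mult_pos2)
    define s where "s = Min (range (($) \<alpha>))"
    have s: "0 < s" "\<And>a. s \<le> \<alpha> $ a" using \<alpha> by (auto simp: s_def)
    \<comment> \<open>typical classes have at least \<open>s n / 2 = k \<delta> n\<close> nodes, so a \<open>k\<close>-th part of one has \<open>\<delta> n\<close>\<close>
    define \<delta> where "\<delta> = s / (2 * k)"
    have \<delta>: "0 < \<delta>" using s k by (simp add: \<delta>_def)
    have deg: "eventually (\<lambda>n. X < \<rho> n * real n) sequentially" for X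
      using expected_degree_at_top[OF rate] by (simp add: filterlim_at_top_dense)
    have bound: "eventually (\<lambda>n. 1 - ?\<delta> n \<le> ?P n (?G n)) sequentially"
      using deg[of "1 / M"] deg[of "16 * K * M / (g\<^sup>2 * \<delta>\<^sup>2)"] deg[of "V / (\<delta>\<^sup>2 * M)"]
        eventually_ge_at_top[of "nat \<lceil>2 / \<delta>\<rceil>"] eventually_gt_at_top[of 0]
    proof eventually_elim
      case (elim n)
      define R where "R = \<rho> n * M"
      define m where "m = \<delta> * real n"
      define v where "v = 4 * (real n * ln k + real n)"
      define B where "B = K * R * real n"
      have n: "0 < n" "1 \<le> real n" using elim(5) by auto
      have R: "0 < R" using \<rho> M by (simp add: R_def)
      have v_eq: "v = V * real n" by (simp add: v_def V_def algebra_simps)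
      have "1 - ?\<delta> n \<le> ?P n {(z, A). \<forall>zh :: nat \<Rightarrow> 'k. is_var_labeling n A zh \<longrightarrow>
          sq_norm n (\<lambda>i j. conn_probs z (\<rho> n *\<^sub>R Q0) i j - var_conn_probs n A zh i j)
            \<le> (real CARD('k))\<^sup>2 * (B + v * R)}"
      proof (rule var_conn_probs_prob[OF pv n(1), where g = "\<rho> n * g" and m = m])
        show "1 \<le> real n * R" using elim(1) M by (simp add: R_def field_simps)
        show "0 < (\<rho> n *\<^sub>R Q0) $ a $ b \<and> (\<rho> n *\<^sub>R Q0) $ a $ b < 1 \<and> (\<rho> n *\<^sub>R Q0) $ a $ b \<le> R" for a b
          using Qn \<rho>[of n] entry_le by (auto simp: R_def)
        show "transpose (\<rho> n *\<^sub>R Q0) = \<rho> n *\<^sub>R Q0"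
          by (simp add: vec_eq_iff transpose_def transpose_eq_self_entry[OF assms(2)])
        show "\<exists>d. \<rho> n * g \<le> \<bar>(\<rho> n *\<^sub>R Q0) $ d $ a - (\<rho> n *\<^sub>R Q0) $ d $ b\<bar>" if ab: "a \<noteq> b" for a b
        proof -
          obtain d where "g \<le> \<bar>Q0 $ d $ a - Q0 $ d $ b\<bar>" using g(2)[OF ab] by blast
          then have "\<rho> n * g \<le> \<rho> n * \<bar>Q0 $ d $ a - Q0 $ d $ b\<bar>" using \<rho>[of n] by simp
          also have "\<dots> = \<bar>(\<rho> n *\<^sub>R Q0) $ d $ a - (\<rho> n *\<^sub>R Q0) $ d $ b\<bar>"
            using \<rho>[of n] by (simp add: right_diff_distrib[symmetric] abs_mult)
          finally show ?thesis by blast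
        qed
        show "0 < \<rho> n * g" using \<rho> g by simp
        show "16 * (real CARD('k))\<^sup>2 * R * (3 / 2 * real n * ln (real CARD('k)) + real n + 1) \<le> B"
        proof -
          have "16 * k\<^sup>2 * R * (3 / 2 * real n * ln k + real n + 1) \<le> 16 * k\<^sup>2 * R * (3 / 2 * real n * ln k + real n + real n)"
            using n R by (intro mult_left_mono) auto
          also have "\<dots> = B" by (simp add: B_def K_def algebra_simps)
          finally show ?thesis by (simp add: k_def)
        qed
        show "real CARD('k) * m \<le> \<alpha> $ a * real n / 2" for a
          using s(2)[of a] k by (simp add: m_def \<delta>_def k_def[symmetric] mult_right_mono)
        show "2 \<le> m"
        proof -
          have "2 / \<delta> \<le> real n" using elim(4) by linarith
          then show ?thesis using \<delta> by (simp add: m_def field_simps)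
        qed
        show "16 * B < (\<rho> n * g)\<^sup>2 * m\<^sup>2"
        proof -
          have "16 * K * M < \<rho> n * real n * (g\<^sup>2 * \<delta>\<^sup>2)"
            using elim(2) g(1) \<delta> by (simp add: pos_divide_less_eq)
          then have "(\<rho> n * real n) * (16 * K * M) < (\<rho> n * real n) * (\<rho> n * real n * (g\<^sup>2 * \<delta>\<^sup>2))"
            using \<rho>[of n] n by (intro mult_strict_left_mono) auto
          then show ?thesis by (simp add: B_def R_def m_def power2_eq_square mult_ac)
        qed
        show "v = 4 * (real n * ln (real CARD('k)) + real n)" by (simp add: v_def k_def)
        show "v \<le> m\<^sup>2 * R"
        proof -
          have "V \<le> \<rho> n * real n * (\<delta>\<^sup>2 * M)"
            using elim(3) M \<delta> by (simp add: pos_divide_less_eq less_imp_le)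
          then have "V * real n \<le> \<rho> n * real n * (\<delta>\<^sup>2 * M) * real n" by (rule mult_right_mono) simp
          then show ?thesis by (simp add: v_eq R_def m_def power2_eq_square mult_ac)
        qed
      qed
      also have "\<dots> \<le> ?P n (?G n)"
      proof (rule measure_pmf.finite_measure_mono)
        have "(real CARD('k))\<^sup>2 * (B + v * R) = k\<^sup>2 * (K + V) * M * (\<rho> n * real n)"
          by (simp add: k_def[symmetric] B_def v_eq R_def algebra_simps)
        also have "\<dots> = C * \<rho> n * (real n * ln k)" using lnk by (simp add: C_def)
        also have "\<dots> \<le> C * \<rho> n * (k\<^sup>2 + real n * ln k)"
          using C \<rho>[of n] by (intro mult_left_mono) auto
        finally have "(real CARD('k))\<^sup>2 * (B + v * R) \<le> C * \<rho> n * ((real CARD('k))\<^sup>2 + real n * ln (real CARD('k)))"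
          by (simp add: k_def)
        then show "{(z, A). \<forall>zh :: nat \<Rightarrow> 'k. is_var_labeling n A zh \<longrightarrow>
          sq_norm n (\<lambda>i j. conn_probs z (\<rho> n *\<^sub>R Q0) i j - var_conn_probs n A zh i j)
            \<le> (real CARD('k))\<^sup>2 * (B + v * R)} \<subseteq> ?G n"
          by (auto intro: order_trans)
      qed simp
      finally show ?case .
    qed
    have "(\<lambda>n. 1 - ?\<delta> n) \<longlonglongrightarrow> 1 - 0"
      by (intro tendsto_diff tendsto_const failure_prob_tendsto_0 \<alpha>)
    then have lower: "(\<lambda>n. 1 - ?\<delta> n) \<longlonglongrightarrow> 1" by simp
    show "(\<lambda>n. ?P n (?G n)) \<longlonglongrightarrow> 1"
      by (rule tendsto_sandwich[OF bound _ lower tendsto_const]) simp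
  qed
qed

end
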